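(* Let $\{Z_t\}$ be a mean-zero, unit-variance stationary Gaussian sequence with $\mathrm{E}Z_0Z_k\sim C_0k^{-\alpha}$ as $k\to\infty$ ($C_0>0$, $0<\alpha<1$), and let $Y_t=\tilde G(Z_t)$ with marginal distribution $F$. Let $T_n=T(F_n)$ be a statistical functional of the empirical distribution $F_n$ of $Y_1,\dots,Y_n$, and suppose $X_t\equiv G(Z_t)=IF(Y_t,F)$ has Hermite rank $m\ge1$ with $\alpha m<1$, Condition-I (stated in the context) holds, and $\ell^{-1}+\ell/n\to0$ as $n\to\infty$. Then, for either overlapping or non-overlapping blocks, $$\widehat V_{\ell,\alpha m}(\widehat X)=\widehat V_{\ell,\alpha m}(X)+O_p\bigl((\ell/n)^{\alpha m/2}\bigr)+O_p\bigl(n^{-\alpha m/2}\bigr).$$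
   Context: $F_n=n^{-1}\sum_{t=1}^n\delta_{Y_t}$, where $\delta_y$ is the unit point mass at $y$. The influence function is $IF(y,F)\equiv\lim_{\epsilon\downarrow0}[T((1-\epsilon)F+\epsilon\delta_y)-T(F)]/\epsilon$, $y\in\mathbb{R}$, and $IF(y,F_n)$ is its version with $F$ replaced by $F_n$; $\mathrm{E}[IF(Y_t,F)]=0$ and $\mathrm{E}[IF(Y_t,F)]^2<\infty$. Put $\widehat X_t\equiv IF(Y_t,F_n)$, $t=1,\dots,n$. Hermite rank of a function $g(Z_t)$ with finite variance: the smallest integer $k\ge1$ with $\mathrm{E}[g(Z_0)H_k(Z_0)]\ne0$, where $H_k(z)=(-1)^ke^{z^2/2}\frac{d^k}{dz^k}e^{-z^2/2}$. A function of $Y_t=\tilde G(Z_t)$ is regarded as a function of $Z_t$. Block estimators. For values $x_1,\dots,x_n$, let $\bar x_{i,\ell}=\ell^{-1}\sum_{j=i}^{i+\ell-1}x_j$. The overlapping-block estimator is $$\widehat V_{\ell,\alpha m,OL}(x)=\frac1N\sum_{i=1}^N\ell^{\alpha m}\Bigl(\bar x_{i,\ell}-\frac1N\sum_{k=1}^N\bar x_{k,\ell}\Bigr)^2,\quad N=n-\ell+1,$$ and the non-overlapping-block estimator is $$\widehat V_{\ell,\alpha m,NOL}(x)=\frac1b\sum_{i=1}^b\ell^{\alpha m}\Bigl(\bar x_{1+(i-1)\ell,\ell}-\frac1b\sum_{k=1}^b\bar x_{1+(k-1)\ell,\ell}\Bigr)^2,\quad b=\lfloor n/\ell\rfloor .$$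 $\widehat V_{\ell,\alpha m}(X)$ (oracle) and $\widehat V_{\ell,\alpha m}(\widehat X)$ (plug-in) denote the estimator of one of these types evaluated at $X_1,\dots,X_n$ and at $\widehat X_1,\dots,\widehat X_n$, respectively. Condition-I: There exist random variables $U_{1,n},U_{2,n},W_n$ and real constants $c,d\in\mathbb{R}$, $C>0$ such that, for any real $y_1,\dots,y_k$ and any $k\ge1$, $$\Bigl|\frac1k\sum_{j=1}^kIF(y_j,F)-\frac1k\sum_{j=1}^kIF(y_j,F_n)+U_{1,n}\Bigr|\le|W_n|+|U_{2,n}|\left(\int_c^d\Bigl|\frac1k\sum_{j=1}^kh_\lambda(y_j)\Bigr|^2d\lambda\right)^{1/2},$$ where $|W_n|=O_p(n^{-\alpha m})$; $|U_{1,n}|,|U_{2,n}|=O_p(n^{-\alpha m/2})$; and, indexed by $\lambda\in[c,d]$, $h_\lambda(\cdot)$ is a real-valued function such that $h_\lambda(Y_t)=h_\lambda(\tilde G(Z_t))$ has mean zero, variance $\mathrm{E}[h_\lambda(Y_t)]^2\le C$, and Hermite rank at least $m$ (the rank of $G(Z_t)=IF(Y_t,F)$). *)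

theory Defs
  imports "HOL-Probability.Probability" "HOL-Library.Landau_Symbols" "HOL-Library.Extended_Nat"
begin

section \<open>Gaussian sequences\<close>

text \<open>Almost surely constant variables are the degenerate normal ones.\<close>

definition gaussian_rv :: "'a measure \<Rightarrow> ('a \<Rightarrow> real) \<Rightarrow> bool" where
  "gaussian_rv M X \<longleftrightarrow> X \<in> borel_measurable M \<and>
     ((\<exists>\<mu> \<sigma>. \<sigma> > 0 \<and> distributed M lborel X (normal_density \<mu> \<sigma>)) \<or>
      (\<exists>\<mu>. AE \<omega> in M. X \<omega> = \<mu>))"

definition gaussian_sequence :: "'a measure \<Rightarrow> (nat \<Rightarrow> 'a \<Rightarrow> real) \<Rightarrow> bool" where
  "gaussian_sequence M Z \<longleftrightarrow>
     (\<forall>J a. finite J \<longrightarrow> gaussian_rv M (\<lambda>\<omega>. \<Sum>j\<in>J. a j * Z j \<omega>))"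

definition stationary_sequence :: "'a measure \<Rightarrow> (nat \<Rightarrow> 'a \<Rightarrow> real) \<Rightarrow> bool" where
  "stationary_sequence M Z \<longleftrightarrow>
     (\<forall>h. distr M (\<Pi>\<^sub>M i\<in>UNIV. borel) (\<lambda>\<omega> i. Z (i + h) \<omega>)
        = distr M (\<Pi>\<^sub>M i\<in>UNIV. borel) (\<lambda>\<omega> i. Z i \<omega>))"

section \<open>Hermite rank\<close>

definition hermite_poly :: "nat \<Rightarrow> real \<Rightarrow> real" where
  "hermite_poly k z = (-1) ^ k * exp (z\<^sup>2 / 2) * (deriv ^^ k) (\<lambda>w. exp (- w\<^sup>2 / 2)) z"

text \<open>The rank is \<open>\<infinity>\<close> if no Hermite coefficient of order at least one is nonzero.
  Used only for \<open>g\<close> such that \<open>g(Z0)\<close> has finite variance.\<close>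

definition hermite_rank :: "'a measure \<Rightarrow> ('a \<Rightarrow> real) \<Rightarrow> (real \<Rightarrow> real) \<Rightarrow> enat" where
  "hermite_rank M Z0 g =
     Inf (enat ` {k. 1 \<le> k \<and> (LINT \<omega>|M. g (Z0 \<omega>) * hermite_poly k (Z0 \<omega>)) \<noteq> 0})"

section \<open>Empirical distribution and influence function\<close>

definition empirical_distribution :: "nat \<Rightarrow> (nat \<Rightarrow> real) \<Rightarrow> real measure" where
  "empirical_distribution n y = distr (uniform_count_measure {1..n}) borel y"

lemma emeasure_empirical_distribution:
  assumes "1 \<le> n" "A \<in> sets borel"
  shows "emeasure (empirical_distribution n y) A
    = (\<Sum>t=1..n. emeasure (return borel (y t)) A) / of_nat n"
proof -
  have m: "y \<in> measurable (uniform_count_measure {1..n}) borel"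
    unfolding measurable_def by (auto simp: space_uniform_count_measure sets_uniform_count_measure)
  let ?S = "y -` A \<inter> {1..n}"
  have "(\<Sum>t=1..n. emeasure (return borel (y t)) A) = (\<Sum>t=1..n. indicator ?S t)"
    using assms by (intro sum.cong) (auto simp: indicator_def)
  also have "\<dots> = of_nat (card ?S)"
    by (simp add: indicator_def sum.If_cases Int_def conj_commute)
  finally have s: "(\<Sum>t=1..n. emeasure (return borel (y t)) A) = of_nat (card ?S)" .
  have "emeasure (empirical_distribution n y) A
      = emeasure (uniform_count_measure {1..n}) ?S"
    unfolding empirical_distribution_def using assms m
    by (simp add: emeasure_distr space_uniform_count_measure)
  also have "\<dots> = of_nat (card ?S) / of_nat n"
    using assms
    by (subst emeasure_uniform_count_measure)
       (auto simp: divide_ennreal ennreal_of_nat_eq_real_of_nat)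
  finally show ?thesis
    using s by simp
qed

text \<open>\<open>contaminate F \<epsilon> y\<close> is the mixture \<open>(1 - \<epsilon>) F + \<epsilon> \<delta>\<^sub>y\<close>.\<close>

definition contaminate :: "real measure \<Rightarrow> real \<Rightarrow> real \<Rightarrow> real measure" where
  "contaminate F \<epsilon> y = measure_of UNIV (sets borel)
     (\<lambda>A. ennreal (1 - \<epsilon>) * emeasure F A + ennreal \<epsilon> * emeasure (return borel y) A)"

lemma emeasure_contaminate:
  assumes "sets F = sets borel" "A \<in> sets borel"
  shows "emeasure (contaminate F \<epsilon> y) A
    = ennreal (1 - \<epsilon>) * emeasure F A + ennreal \<epsilon> * emeasure (return borel y) A"
proof -
  let ?\<mu> = "\<lambda>A. ennreal (1 - \<epsilon>) * emeasure F A + ennreal \<epsilon> * emeasure (return borel y) A"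
  have "countably_additive (sets borel) ?\<mu>"
  proof (rule countably_additiveI)
    fix B :: "nat \<Rightarrow> real set"
    assume B: "range B \<subseteq> sets borel" "disjoint_family B"
    have "(\<Sum>i. emeasure F (B i)) = emeasure F (\<Union>i. B i)"
      using B assms by (intro suminf_emeasure) auto
    moreover have "(\<Sum>i. emeasure (return borel y) (B i)) = emeasure (return borel y) (\<Union>i. B i)"
      using B by (intro suminf_emeasure) auto
    ultimately show "(\<Sum>i. ?\<mu> (B i)) = ?\<mu> (\<Union>i. B i)"
      by (simp add: suminf_add[symmetric] ennreal_suminf_cmult)
  qed
  moreover have "positive (sets borel) ?\<mu>"
    by (simp add: positive_def)
  moreover have "sigma_algebra UNIV (sets borel :: real set set)"
    using sets.sigma_algebra_axioms[of "borel :: real measure"] by simp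
  ultimately show ?thesis
    unfolding contaminate_def using assms(2)
    by (intro emeasure_measure_of_sigma)
qed

definition influence_quotient :: "(real measure \<Rightarrow> real) \<Rightarrow> real measure \<Rightarrow> real \<Rightarrow> real \<Rightarrow> real" where
  "influence_quotient T F y \<epsilon> = (T (contaminate F \<epsilon> y) - T F) / \<epsilon>"

text \<open>\<open>IF T y F\<close> is meaningful only where the limit exists, that is, if
  \<open>has_influence_function T F\<close>.\<close>

definition IF :: "(real measure \<Rightarrow> real) \<Rightarrow> real \<Rightarrow> real measure \<Rightarrow> real" where
  "IF T y F = Lim (at_right 0) (influence_quotient T F y)"

definition has_influence_function :: "(real measure \<Rightarrow> real) \<Rightarrow> real measure \<Rightarrow> bool" where
  "has_influence_function T F \<longleftrightarrow>
     (\<forall>y. \<exists>L. (influence_quotient T F y \<longlongrightarrow> L) (at_right 0))"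

section \<open>Stochastic order\<close>

text \<open>\<open>big_Op M X a\<close> is \<open>X\<^sub>n = O\<^sub>p(a\<^sub>n)\<close>. The event is asked to lie in a measurable set of small
  probability, so that the notion is not vacuous for non-measurable \<open>X\<^sub>n\<close>; for random variables
  this is the usual condition, see \<open>big_Op_iff\<close>.\<close>

definition big_Op :: "'a measure \<Rightarrow> (nat \<Rightarrow> 'a \<Rightarrow> real) \<Rightarrow> (nat \<Rightarrow> real) \<Rightarrow> bool" where
  "big_Op M X a \<longleftrightarrow>
     (\<forall>\<epsilon>>0. \<exists>K>0. \<forall>\<^sub>F n in sequentially.
        \<exists>A\<in>sets M. {\<omega>\<in>space M. \<bar>X n \<omega>\<bar> > K * a n} \<subseteq> A \<and> measure M A \<le> \<epsilon>)"

lemma big_Op_iff: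
  assumes "prob_space M" and X: "\<And>n. X n \<in> borel_measurable M"
  shows "big_Op M X a \<longleftrightarrow>
     (\<forall>\<epsilon>>0. \<exists>K>0. \<forall>\<^sub>F n in sequentially. measure M {\<omega>\<in>space M. \<bar>X n \<omega>\<bar> > K * a n} \<le> \<epsilon>)"
proof -
  interpret prob_space M by fact
  have "(\<exists>A\<in>sets M. {\<omega>\<in>space M. \<bar>X n \<omega>\<bar> > K * a n} \<subseteq> A \<and> measure M A \<le> \<epsilon>)
    \<longleftrightarrow> measure M {\<omega>\<in>space M. \<bar>X n \<omega>\<bar> > K * a n} \<le> \<epsilon>" for n K \<epsilon>
  proof -
    have "{\<omega>\<in>space M. \<bar>X n \<omega>\<bar> > K * a n} \<in> sets M"
      using X[of n] by measurable
    then show ?thesis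
      by (meson finite_measure_mono order_trans order_refl)
  qed
  then show ?thesis
    by (simp add: big_Op_def)
qed

section \<open>Block estimators\<close>

definition block_mean :: "nat \<Rightarrow> (nat \<Rightarrow> real) \<Rightarrow> nat \<Rightarrow> real" where
  "block_mean l x i = (\<Sum>j=i..i+l-1. x j) / real l"

text \<open>The parameter \<open>\<beta>\<close> stands for \<open>\<alpha> m\<close>.\<close>

definition V_OL :: "nat \<Rightarrow> nat \<Rightarrow> real \<Rightarrow> (nat \<Rightarrow> real) \<Rightarrow> real" where
  "V_OL n l \<beta> x = (let N = n - l + 1 in
     (\<Sum>i=1..N. (real l powr \<beta>) *
        (block_mean l x i - (\<Sum>k=1..N. block_mean l x k) / real N)\<^sup>2) / real N)"

definition V_NOL :: "nat \<Rightarrow> nat \<Rightarrow> real \<Rightarrow> (nat \<Rightarrow> real) \<Rightarrow> real" where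
  "V_NOL n l \<beta> x = (let b = n div l in
     (\<Sum>i=1..b. (real l powr \<beta>) *
        (block_mean l x (1 + (i - 1) * l) - (\<Sum>k=1..b. block_mean l x (1 + (k - 1) * l)) / real b)\<^sup>2)
     / real b)"

section \<open>Condition-I\<close>

text \<open>The inequality is required almost surely, simultaneously for all \<open>k\<close> and \<open>y\<close>. Since the
  library integral of a non-integrable function is 0, the inequality is imposed only where the
  integral on its right-hand side is finite; elsewhere that side is infinite and there is nothing
  to require. Joint measurability of \<open>h\<close> makes these integrals well defined.\<close>

definition condition_I ::
  "'a measure \<Rightarrow> (nat \<Rightarrow> 'a \<Rightarrow> real) \<Rightarrow> (real \<Rightarrow> real) \<Rightarrow> (real measure \<Rightarrow> real) \<Rightarrow>
   real measure \<Rightarrow> (nat \<Rightarrow> 'a \<Rightarrow> real measure) \<Rightarrow> real \<Rightarrow> nat \<Rightarrow> bool"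
where
  "condition_I M Z Gt T F Fn \<alpha> m \<longleftrightarrow>
    (\<exists>(U1 :: nat \<Rightarrow> 'a \<Rightarrow> real) U2 W c d C (h :: real \<Rightarrow> real \<Rightarrow> real).
       C > 0 \<and>
       (\<forall>n. U1 n \<in> borel_measurable M \<and> U2 n \<in> borel_measurable M \<and> W n \<in> borel_measurable M) \<and>
       (\<forall>n\<ge>1. AE \<omega> in M. \<forall>k\<ge>1. \<forall>y :: nat \<Rightarrow> real.
          set_integrable lborel {c..d} (\<lambda>v. \<bar>(\<Sum>j=1..k. h v (y j)) / real k\<bar>\<^sup>2) \<longrightarrow>
          \<bar>(\<Sum>j=1..k. IF T (y j) F) / real k
            - (\<Sum>j=1..k. IF T (y j) (Fn n \<omega>)) / real k
            + U1 n \<omega>\<bar>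
          \<le> \<bar>W n \<omega>\<bar> + \<bar>U2 n \<omega>\<bar> *
              sqrt (LINT v:{c..d}|lborel. \<bar>(\<Sum>j=1..k. h v (y j)) / real k\<bar>\<^sup>2)) \<and>
       big_Op M W (\<lambda>n. real n powr (- \<alpha> * real m)) \<and>
       big_Op M U1 (\<lambda>n. real n powr (- \<alpha> * real m / 2)) \<and>
       big_Op M U2 (\<lambda>n. real n powr (- \<alpha> * real m / 2)) \<and>
       (\<lambda>(v, y). h v y) \<in> borel_measurable (restrict_space borel {c..d} \<Otimes>\<^sub>M borel) \<and>
       (\<forall>v\<in>{c..d}.
          (\<forall>t. integrable M (\<lambda>\<omega>. (h v (Gt (Z t \<omega>)))\<^sup>2) \<and>
               (LINT \<omega>|M. h v (Gt (Z t \<omega>))) = 0 \<and>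
               (LINT \<omega>|M. (h v (Gt (Z t \<omega>)))\<^sup>2) \<le> C) \<and>
          hermite_rank M (Z 0) (\<lambda>z. h v (Gt z)) \<ge> enat m))"

end

theory Submission
  imports Defs "HOL-Computational_Algebra.Polynomial"
begin

text \<open>Put \<open>\<beta> = \<alpha> m\<close> and let \<open>D\<^sub>i\<close> be the difference of the oracle and plug-in block means plus
  \<open>U\<^sub>1\<^sub>,\<^sub>n\<close>. The estimators are \<open>l\<^sup>\<beta>\<close> times empirical variances, which ignore the common shift
  \<open>U\<^sub>1\<^sub>,\<^sub>n\<close>, so by Cauchy-Schwarz they differ by at most \<open>V(D) + 2 sqrt (V(X) V(D))\<close>. Condition-I bounds
  \<open>V(D)\<close> by \<open>2 l\<^sup>\<beta> W\<^sup>2 + 2 U\<^sub>2\<^sup>2 Q\<close>, where \<open>Q\<close> is \<open>l\<^sup>\<beta>\<close> times the average over blocks of the integrated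
  squared block means of \<open>h\<close>. Both \<open>V(X)\<close> and \<open>Q\<close> are bounded in expectation, hence
  \<open>V(D) = O\<^sub>p((l / n)\<^sup>\<beta>)\<close> and the difference is \<open>O\<^sub>p((l / n) powr (\<beta> / 2))\<close>; as \<open>l \<ge> 1\<close> this
  absorbs the other error term.

  The expectation bounds come from \<open>\<bar>E f(Z\<^sub>i) f(Z\<^sub>j)\<bar> \<le> const * \<bar>\<rho>\<bar>\<^sup>m E f\<^sup>2\<close> for correlation
  \<open>\<bar>\<rho>\<bar> \<le> 1/2\<close> and \<open>f\<close> orthogonal to the Hermite polynomials of degree below \<open>m\<close>. The expectation on
  the left is a quadratic form in \<open>f\<close> given by the Mehler kernel; its first \<open>m\<close> Hermite terms do
  not contribute, and the rest has squared Hilbert-Schmidt norm \<open>\<rho>\<^sup>2\<^sup>m / (1 - \<rho>\<^sup>2)\<close>.\<close>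

section \<open>Hermite polynomials\<close>

text \<open>Differentiating \<open>(-1) ^ k * hermite k * exp (- z^2 / 2)\<close> once more produces
  this recursion. Formal polynomials make \<open>pderiv\<close> and \<open>pcompose\<close>
  available where \<open>hermite_poly\<close> offers only iterated derivatives.\<close>

primrec hermite :: "nat \<Rightarrow> real poly" where
  "hermite 0 = 1"
| "hermite (Suc k) = [:0, 1:] * hermite k - pderiv (hermite k)"

lemma hermite_poly_eq_poly: "hermite_poly k z = poly (hermite k) z"
proof -
  have "(deriv ^^ k) (\<lambda>w. exp (- w\<^sup>2 / 2)) = (\<lambda>z. (-1) ^ k * poly (hermite k) z * exp (- z\<^sup>2 / 2))"
  proof (induction k)
    case (Suc k)
    have "((\<lambda>z. (-1) ^ k * poly (hermite k) z * exp (- z\<^sup>2 / 2)) has_real_derivative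
        (-1) ^ Suc k * poly (hermite (Suc k)) z * exp (- z\<^sup>2 / 2)) (at z)" for z
      by (rule derivative_eq_intros refl poly_DERIV | simp)+ (simp add: algebra_simps)
    then show ?case
      using Suc by (auto simp: DERIV_imp_deriv)
  qed simp
  moreover have "(-1 :: real) ^ k * (-1) ^ k = 1"
    by (simp flip: power_mult_distrib)
  moreover have "exp (z\<^sup>2 / 2) * exp (- z\<^sup>2 / 2) = 1"
    by (simp flip: exp_add)
  ultimately show ?thesis
    by (simp add: hermite_poly_def mult.assoc) (simp add: mult.left_commute)
qed

text \<open>Differentiating the recursion and inserting the induction hypothesis leaves
  \<open>hermite (Suc k)\<close> plus \<open>Suc k\<close> times
  \<open>[:0, 1:] * hermite k - pderiv (hermite k)\<close>, and that difference is
  \<open>hermite (Suc k)\<close> again.\<close>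

lemma pderiv_hermite_Suc: "pderiv (hermite (Suc k)) = smult (real (Suc k)) (hermite k)"
proof (induction k)
  case (Suc k)
  have "pderiv (hermite (Suc (Suc k))) =
      hermite (Suc k) + smult (real (Suc k)) ([:0, 1:] * hermite k - pderiv (hermite k))"
    unfolding hermite.simps(2)[of "Suc k"] pderiv_diff pderiv_mult Suc pderiv_smult
    by (simp add: pderiv_pCons algebra_simps smult_diff_right)
  also have "\<dots> = smult (real (Suc (Suc k))) (hermite (Suc k))"
    unfolding hermite.simps(2)[symmetric] by (simp only: of_nat_Suc[of "Suc k"] smult_add_left smult_1_left)
  finally show ?case .
qed (simp add: pderiv_pCons)

section \<open>Moments of the standard normal law and Stein's identity\<close>

lemma integrable_std_normal_poly [simp]: "integrable std_normal_distribution (poly p)"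
  unfolding poly_altdef using integrable_std_normal_distribution_moment by auto

lemma integrable_std_normal_poly_mult [simp]:
  "integrable std_normal_distribution (\<lambda>x. poly p x * poly q x)"
proof -
  have "(\<lambda>x. poly p x * poly q x) = poly (p * q)"
    by (simp add: fun_eq_iff)
  then show ?thesis by simp
qed

lemma std_normal_moment_Suc:
  "(LINT x|std_normal_distribution. x ^ Suc n)
    = real n * (LINT x|std_normal_distribution. x ^ (n - 1))"
\<comment> \<open>For odd \<open>n\<close> both moments have even order and the factorial formula
  applies. For even \<open>n\<close> both sides vanish; at \<open>n = 0\<close> the factor
  \<open>real n\<close> neutralises the truncated exponent \<open>n - 1\<close>.\<close>
proof (cases "odd n")
  case True
  then obtain k where n: "n = 2 * k + 1" by (elim oddE)
  have "(LINT x|std_normal_distribution. x ^ Suc n) = fact (2 * Suc k) / (2 ^ Suc k * fact (Suc k))"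
    using std_normal_distribution_even_moments(1)[of "Suc k"] n by simp
  also have "\<dots> = real n * (fact (2 * k) / (2 ^ k * fact k))"
  proof -
    have "fact (2 * Suc k) = (2 * real k + 2) * ((2 * real k + 1) * fact (2 * k))"
      by (simp add: algebra_simps)
    moreover have "(2 :: real) ^ Suc k * fact (Suc k) = (2 * real k + 2) * (2 ^ k * fact k)"
      by (simp add: algebra_simps)
    moreover have "2 * real k + 2 \<noteq> 0" "real n = 2 * real k + 1"
      by (simp_all add: n)
    ultimately show ?thesis
      by (simp only: mult_divide_mult_cancel_left times_divide_eq_right simp_thms)
  qed
  also have "\<dots> = real n * (LINT x|std_normal_distribution. x ^ (n - 1))"
    using std_normal_distribution_even_moments(1)[of k] n by simp
  finally show ?thesis .
next
  case False
  then show ?thesis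
    by (cases n) (simp_all add: integral_std_normal_distribution_moment_odd
      integral_std_normal_distribution_moment_odd[of 1, simplified] del: power_Suc)
qed

text \<open>Gaussian integration by parts. By linearity monomials suffice, and for them the identity
  is \<open>std_normal_moment_Suc\<close>.\<close>

lemma std_normal_stein:
  "(LINT x|std_normal_distribution. x * poly p x)
    = (LINT x|std_normal_distribution. poly (pderiv p) x)"
proof -
  have "pderiv (sum f A) = (\<Sum>i\<in>A. pderiv (f i))" for f :: "nat \<Rightarrow> real poly" and A
    by (induction A rule: infinite_finite_induct) (simp_all add: pderiv_add)
  then have p: "poly (pderiv p) x = (\<Sum>i\<le>degree p. coeff p i * (real i * x ^ (i - 1)))" for x
    by (subst (1) poly_as_sum_of_monoms[symmetric])
      (simp add: pderiv_monom poly_sum poly_monom mult.left_commute mult.assoc del: poly_as_sum_of_monoms)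
  have "(LINT x|std_normal_distribution. x * poly p x)
    = (LINT x|std_normal_distribution. (\<Sum>i\<le>degree p. coeff p i * x ^ Suc i))"
    by (simp add: poly_altdef sum_distrib_left algebra_simps)
  also have "\<dots> = (\<Sum>i\<le>degree p. coeff p i * (LINT x|std_normal_distribution. x ^ Suc i))"
    using integrable_std_normal_distribution_moment
    by (subst Bochner_Integration.integral_sum) (auto simp del: power_Suc)
  also have "\<dots> = (\<Sum>i\<le>degree p. coeff p i * (real i * (LINT x|std_normal_distribution. x ^ (i - 1))))"
    by (simp only: std_normal_moment_Suc)
  also have "\<dots> = (LINT x|std_normal_distribution. (\<Sum>i\<le>degree p. coeff p i * (real i * x ^ (i - 1))))"
    using integrable_std_normal_distribution_moment
    by (subst Bochner_Integration.integral_sum) (auto simp del: power_Suc)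
  finally show ?thesis
    by (simp add: p)
qed

text \<open>Under the standard normal law the adjoint of differentiation sends \<open>p\<close> to
  \<open>[:0, 1:] * p - pderiv p\<close>, which is one step of the Hermite recursion. It follows
  from Stein's identity for \<open>hermite k * q\<close>: the product rule cancels the term with
  \<open>pderiv (hermite k)\<close>.\<close>

lemma hermite_shift:
  "(LINT x|std_normal_distribution. poly (hermite (Suc k)) x * poly q x)
    = (LINT x|std_normal_distribution. poly (hermite k) x * poly (pderiv q) x)"
proof -
  have i1: "integrable std_normal_distribution (\<lambda>x. x * poly (hermite k * q) x)"
    using integrable_std_normal_poly_mult[of "[:0, 1:]" "hermite k * q"] by (simp del: poly_mult)
  have "(LINT x|std_normal_distribution. poly (hermite (Suc k)) x * poly q x)
      = (LINT x|std_normal_distribution. x * poly (hermite k * q) x - poly (pderiv (hermite k)) x * poly q x)"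
    by (simp add: algebra_simps)
  also have "\<dots> = (LINT x|std_normal_distribution. poly (pderiv (hermite k * q)) x)
      - (LINT x|std_normal_distribution. poly (pderiv (hermite k)) x * poly q x)"
    by (subst Bochner_Integration.integral_diff) (auto simp: i1 std_normal_stein simp del: poly_mult)
  also have "\<dots> = (LINT x|std_normal_distribution. poly (hermite k) x * poly (pderiv q) x)"
    using integrable_std_normal_poly_mult[of q "pderiv (hermite k)"]
    by (simp add: pderiv_mult mult.commute)
  finally show ?thesis .
qed

text \<open>\<open>hermite_shift\<close> lowers \<open>j\<close> by one and differentiates the other
  factor, which by \<open>pderiv_hermite_Suc\<close> lowers \<open>k\<close> by one at the cost of a
  factor \<open>k\<close>. The factors multiply up to \<open>fact k\<close>; unequal indices end at
  the derivative of a constant.\<close>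

lemma hermite_orthogonal:
  "(LINT x|std_normal_distribution. poly (hermite j) x * poly (hermite k) x)
    = (if j = k then fact k else 0)"
proof (induction j arbitrary: k)
  case 0
  interpret prob_space std_normal_distribution
    using real_dist_normal_dist by (simp add: real_distribution_def)
  show ?case
  proof (cases k)
    case (Suc n)
    then show ?thesis
      using hermite_shift[of n 1] by simp
  qed (use prob_space in simp)
next
  case (Suc j)
  show ?case
  proof (cases k)
    case 0
    then show ?thesis
      using hermite_shift[of j 1] by simp
  next
    case (Suc n)
    then show ?thesis
      using hermite_shift[of j "hermite k"] Suc.IH[of n]
      by (simp add: pderiv_hermite_Suc mult.left_commute del: hermite.simps)
  qed
qed

text \<open>Hermite polynomials are eigenfunctions of the Ornstein-Uhlenbeck averaging. After one
  step of the recursion, Stein's identity in \<open>x\<close> turns the term \<open>s * x\<close>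
  into \<open>s * s\<close> times the derivative, so the derivative keeps the coefficient
  \<open>s * s - 1\<close>, which is minus the square of \<open>\<rho>\<close>; its own average is
  known from a lower degree.\<close>

lemma hermite_mehler:
  assumes "\<rho>\<^sup>2 + s\<^sup>2 = 1"
  shows "(LINT x|std_normal_distribution. poly (hermite k) (\<rho> * u + s * x)) = \<rho> ^ k * poly (hermite k) u"
proof (induction k rule: less_induct)
  case (less k)
  interpret prob_space std_normal_distribution
    using real_dist_normal_dist by (simp add: real_distribution_def)
  let ?N = std_normal_distribution
  let ?L = "[:\<rho> * u, s:]"
  have [simp]: "integrable ?N (\<lambda>x. poly q (\<rho> * u + s * x))"
    "integrable ?N (\<lambda>x. x * poly q (\<rho> * u + s * x))" for q
    using integrable_std_normal_poly_mult[of 1 "pcompose q ?L"]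
      integrable_std_normal_poly_mult[of "[:0, 1:]" "pcompose q ?L"]
    by (simp_all add: poly_pcompose algebra_simps)
  have stein: "(LINT x|?N. x * poly q (\<rho> * u + s * x)) = s * (LINT x|?N. poly (pderiv q) (\<rho> * u + s * x))" for q
    using std_normal_stein[of "pcompose q ?L"]
    by (simp add: poly_pcompose pderiv_pcompose pderiv_pCons mult.commute)
  show ?case
  proof (cases k)
    case (Suc n)
    let ?D = "LINT x|?N. poly (pderiv (hermite n)) (\<rho> * u + s * x)"
    \<comment> \<open>The factor \<open>\<rho>\<close> makes up for the degree lost by
      differentiation.\<close>
    have D: "?D * \<rho> = \<rho> ^ n * poly (pderiv (hermite n)) u"
    proof (cases n)
      case (Suc r)
      then show ?thesis
        using less.IH[of r] \<open>k = Suc n\<close> by (simp add: pderiv_hermite_Suc del: hermite.simps)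
    qed simp
    have "(LINT x|?N. poly (hermite k) (\<rho> * u + s * x)) =
       (LINT x|?N. \<rho> * u * poly (hermite n) (\<rho> * u + s * x) + s * (x * poly (hermite n) (\<rho> * u + s * x))
          - poly (pderiv (hermite n)) (\<rho> * u + s * x))"
      by (simp add: Suc algebra_simps)
    also have "\<dots> = \<rho> * u * (LINT x|?N. poly (hermite n) (\<rho> * u + s * x)) + s * (s * ?D) - ?D"
      by (simp add: stein)
    also have "\<dots> = \<rho> * u * (\<rho> ^ n * poly (hermite n) u) - (1 - s\<^sup>2) * ?D"
      using less.IH[of n] Suc by (simp add: algebra_simps power2_eq_square)
    also have "(1 - s\<^sup>2) * ?D = \<rho> * (?D * \<rho>)"
      using assms by (simp add: power2_eq_square algebra_simps flip: assms)
    finally show ?thesis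
      unfolding D by (simp add: Suc algebra_simps)
  qed (use prob_space in simp)
qed

section \<open>The Mehler kernel\<close>

lemma integrable_mult_L2:
  fixes f g :: "'a \<Rightarrow> real"
  assumes [measurable]: "f \<in> borel_measurable M" "g \<in> borel_measurable M"
    and "integrable M (\<lambda>x. (f x)\<^sup>2)" "integrable M (\<lambda>x. (g x)\<^sup>2)"
  shows "integrable M (\<lambda>x. f x * g x)"
proof (rule Bochner_Integration.integrable_bound)
  show "integrable M (\<lambda>x. (f x)\<^sup>2 + (g x)\<^sup>2)"
    using assms by simp
  have "\<bar>a * b\<bar> \<le> \<bar>a\<^sup>2 + b\<^sup>2\<bar>" for a b :: real
  proof -
    have "2 * \<bar>a * b\<bar> \<le> a\<^sup>2 + b\<^sup>2"
      using sum_squares_bound[of "\<bar>a\<bar>" "\<bar>b\<bar>"] by (simp add: abs_mult)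
    then show ?thesis
      by linarith
  qed
  then show "AE x in M. norm (f x * g x) \<le> norm ((f x)\<^sup>2 + (g x)\<^sup>2)"
    by simp
qed measurable

lemma integral_Cauchy_Schwarz:
  fixes f g :: "'a \<Rightarrow> real"
  assumes [measurable]: "f \<in> borel_measurable M" "g \<in> borel_measurable M"
    and f: "integrable M (\<lambda>x. (f x)\<^sup>2)" and g: "integrable M (\<lambda>x. (g x)\<^sup>2)"
  shows "(LINT x|M. f x * g x)\<^sup>2 \<le> (LINT x|M. (f x)\<^sup>2) * (LINT x|M. (g x)\<^sup>2)"
proof -
  let ?a = "LINT x|M. (f x)\<^sup>2" and ?b = "LINT x|M. f x * g x" and ?c = "LINT x|M. (g x)\<^sup>2"
  note fg = integrable_mult_L2[OF assms]
  have q: "0 \<le> t\<^sup>2 * ?a - 2 * t * s * ?b + s\<^sup>2 * ?c" for t s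
  proof -
    have "0 \<le> (LINT x|M. (t * f x - s * g x)\<^sup>2)"
      by (rule integral_nonneg_AE) simp
    also have "\<dots> = (LINT x|M. t\<^sup>2 * (f x)\<^sup>2 - 2 * t * s * (f x * g x) + s\<^sup>2 * (g x)\<^sup>2)"
      by (simp add: power2_eq_square algebra_simps)
    finally show ?thesis
      using f g fg by simp
  qed
  have "?a \<ge> 0" "?c \<ge> 0" by simp_all
  show ?thesis
  proof (cases "?a = 0")
    case True
    have "?b = 0"
    proof (rule ccontr)
      assume "?b \<noteq> 0"
      then show False
        \<comment> \<open>With \<open>?a = 0\<close> the form is affine in \<open>t\<close>, and
          this \<open>t\<close> gives it the value -1.\<close>
        using q[of "(?c + 1) / (2 * ?b)" 1] True by simp
    qed
    then show ?thesis using True by simp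
  next
    case False
    then have "?a > 0" using \<open>?a \<ge> 0\<close> by linarith
    \<comment> \<open>The form at its minimiser \<open>t / s = ?b / ?a\<close>, cleared of
      denominators.\<close>
    have "0 \<le> ?a * (?a * ?c - ?b\<^sup>2)"
      using q[of ?b ?a] by (simp add: power2_eq_square algebra_simps)
    then show ?thesis
      using \<open>?a > 0\<close> by (simp add: zero_le_mult_iff)
  qed
qed

lemma prob_space_std_normal: "prob_space std_normal_distribution"
  using real_dist_normal_dist by (simp add: real_distribution_def)

interpretation std_normal: prob_space std_normal_distribution
  by (rule prob_space_std_normal)

interpretation std_normal2: pair_prob_space std_normal_distribution std_normal_distribution ..

abbreviation std_normal2 :: "(real \<times> real) measure" where
  "std_normal2 \<equiv> std_normal_distribution \<Otimes>\<^sub>M std_normal_distribution"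

text \<open>The density of \<open>\<rho> * x + sqrt (1 - \<rho>\<^sup>2) * \<xi>\<close>, \<open>\<xi>\<close> standard normal, with respect to the standard
  normal law.\<close>

definition mehler :: "real \<Rightarrow> real \<Rightarrow> real \<Rightarrow> real" where
  "mehler \<rho> x y = normal_density (\<rho> * x) (sqrt (1 - \<rho>\<^sup>2)) y / std_normal_density y"

lemma borel_measurable_normal_density_mean [measurable]:
  "(\<lambda>x. normal_density (f x) \<sigma> (g x)) \<in> borel_measurable M"
  if [measurable]: "f \<in> borel_measurable M" "g \<in> borel_measurable M"
  unfolding normal_density_def by measurable

lemma borel_measurable_mehler [measurable]:
  "(\<lambda>x. mehler \<rho> (f x) (g x)) \<in> borel_measurable M"
  if [measurable]: "f \<in> borel_measurable M" "g \<in> borel_measurable M"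
  unfolding mehler_def by measurable

text \<open>The standard normal density cancels and leaves the normal density with mean
  \<open>\<rho> * x\<close>; the affine substitution \<open>y = \<rho> * x + s * z\<close>
  standardises it.\<close>

lemma integral_mehler:
  fixes g :: "real \<Rightarrow> real"
  assumes [measurable]: "g \<in> borel_measurable borel" and "\<bar>\<rho>\<bar> < 1"
  shows "(LINT y|std_normal_distribution. mehler \<rho> x y * g y)
    = (LINT z|std_normal_distribution. g (\<rho> * x + sqrt (1 - \<rho>\<^sup>2) * z))"
proof -
  define s where "s = sqrt (1 - \<rho>\<^sup>2)"
  have s: "s > 0"
    using assms(2) by (simp add: s_def abs_square_less_1)
  have d: "normal_density (\<rho> * x) s (\<rho> * x + s * z) * s = std_normal_density z" for z
    using s by (simp add: normal_density_def power_mult_distrib real_sqrt_mult divide_simps)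
  have "(LINT y|std_normal_distribution. mehler \<rho> x y * g y)
      = (LINT y|lborel. normal_density (\<rho> * x) s y * g y)"
    using normal_density_pos[of 1 0]
    by (subst integral_real_density)
      (auto simp: mehler_def s_def less_imp_neq[symmetric] intro!: Bochner_Integration.integral_cong)
  also have "\<dots> = \<bar>s\<bar> * (LINT z|lborel. normal_density (\<rho> * x) s (\<rho> * x + s * z) * g (\<rho> * x + s * z))"
    using s by (subst lborel_integral_real_affine[where c = s and t = "\<rho> * x"]) simp_all
  also have "\<dots> = (LINT z|lborel. normal_density (\<rho> * x) s (\<rho> * x + s * z) * s * g (\<rho> * x + s * z))"
    using s by (simp add: ac_simps flip: Bochner_Integration.integral_mult_right_zero)
  also have "\<dots> = (LINT z|std_normal_distribution. g (\<rho> * x + s * z))"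
    unfolding d by (subst integral_real_density) auto
  finally show ?thesis
    by (simp add: s_def)
qed

text \<open>Completing the square in \<open>y\<close> splits the weight into a normal density in
  \<open>x\<close> and a normal density in \<open>y\<close> whose mean depends on \<open>x\<close>,
  so the double integral of the squared kernel can be read off as the leading constant.\<close>

lemma mehler_square_density:
  assumes "\<bar>\<rho>\<bar> < 1"
  shows "std_normal_density x * (std_normal_density y * (mehler \<rho> x y)\<^sup>2)
    = 1 / (1 - \<rho>\<^sup>2) * normal_density 0 (sqrt ((1 + \<rho>\<^sup>2) / (1 - \<rho>\<^sup>2))) x
        * normal_density (2 * \<rho> * x / (1 + \<rho>\<^sup>2)) (sqrt ((1 - \<rho>\<^sup>2) / (1 + \<rho>\<^sup>2))) y"
proof -
  define a where "a = 1 - \<rho>\<^sup>2"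
  define b where "b = 1 + \<rho>\<^sup>2"
  have pos: "a > 0" "b > 0"
    using assms by (auto simp: a_def b_def abs_square_less_1 add_pos_nonneg)
  have b: "b = 2 - a" "\<rho>\<^sup>2 = 1 - a"
    by (auto simp: a_def b_def)
  have "std_normal_density x * (std_normal_density y * (mehler \<rho> x y)\<^sup>2)
      = std_normal_density x * ((normal_density (\<rho> * x) (sqrt a) y)\<^sup>2 / std_normal_density y)"
    using normal_density_pos[of 1 0 y] by (simp add: mehler_def a_def power2_eq_square)
  also have "\<dots> = 1 / (2 * pi * a) * exp (- x\<^sup>2 / 2 + 2 * (- (y - \<rho> * x)\<^sup>2 / (2 * a)) - (- y\<^sup>2 / 2))"
    unfolding exp_add exp_diff exp_double using pos
    by (simp add: normal_density_def power_divide power_mult_distrib real_sqrt_mult)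
  also have "- x\<^sup>2 / 2 + 2 * (- (y - \<rho> * x)\<^sup>2 / (2 * a)) - (- y\<^sup>2 / 2)
      = - x\<^sup>2 / (2 * (b / a)) + (- (y - 2 * \<rho> * x / b)\<^sup>2 / (2 * (a / b)))"
  \<comment> \<open>After multiplication by \<open>2 * a * b\<close> the identity between the
    exponents becomes polynomial.\<close>
  proof -
    have "(- x\<^sup>2 / 2 + 2 * (- (y - \<rho> * x)\<^sup>2 / (2 * a)) - (- y\<^sup>2 / 2)) * (2 * a * b)
      = - x\<^sup>2 * a * b - 2 * b * (y - \<rho> * x)\<^sup>2 + y\<^sup>2 * a * b"
      using pos by (simp add: field_simps)
    also have "\<dots> = - x\<^sup>2 * a * a - (b * y - 2 * \<rho> * x)\<^sup>2"
      unfolding a_def b_def by algebra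
    also have "\<dots> = (- x\<^sup>2 / (2 * (b / a)) + (- (y - 2 * \<rho> * x / b)\<^sup>2 / (2 * (a / b)))) * (2 * a * b)"
    proof -
      have "(y - 2 * \<rho> * x / b) = (b * y - 2 * \<rho> * x) / b"
        using pos by (simp add: field_simps)
      then show ?thesis
        using pos by (simp add: power_divide) (simp add: field_simps power2_eq_square)
    qed
    finally show ?thesis
      using pos by simp
  qed
  also have "1 / (2 * pi * a) * exp (- x\<^sup>2 / (2 * (b / a)) + (- (y - 2 * \<rho> * x / b)\<^sup>2 / (2 * (a / b))))
      = 1 / a * normal_density 0 (sqrt (b / a)) x * normal_density (2 * \<rho> * x / b) (sqrt (a / b)) y"
  proof -
    \<comment> \<open>The two variances are reciprocal, so the product of the normalising constants
      does not depend on \<open>\<rho>\<close>.\<close>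
    have "sqrt (2 * pi * (b / a)) * sqrt (2 * pi * (a / b)) = sqrt ((2 * pi)\<^sup>2)"
      unfolding real_sqrt_mult[symmetric] using pos
      by (intro arg_cong[where f = sqrt]) (simp add: power2_eq_square)
    also have "\<dots> = 2 * pi"
      by (rule real_sqrt_unique) simp_all
    finally have c: "sqrt (2 * pi * (b / a)) * sqrt (2 * pi * (a / b)) = 2 * pi" .
    have v: "(sqrt (b / a))\<^sup>2 = b / a" "(sqrt (a / b))\<^sup>2 = a / b"
      using pos by simp_all
    have "1 / (2 * pi * a)
        = 1 / a * (1 / (sqrt (2 * pi * (b / a)) * sqrt (2 * pi * (a / b))))"
      unfolding c by simp
    then show ?thesis
      unfolding normal_density_def v exp_add by (simp only: ac_simps times_divide_times_eq) simp
  qed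
  finally show ?thesis
    by (simp add: a_def b_def)
qed

lemma nn_integral_normal_density: "\<sigma> > 0 \<Longrightarrow> (\<integral>\<^sup>+x. normal_density \<mu> \<sigma> x \<partial>lborel) = 1"
  by (simp add: nn_integral_eq_integral)

lemma nn_integral_mehler_square:
  assumes "\<bar>\<rho>\<bar> < 1"
  shows "(\<integral>\<^sup>+p. (mehler \<rho> (fst p) (snd p))\<^sup>2 \<partial>std_normal2) = ennreal (1 / (1 - \<rho>\<^sup>2))"
proof -
  have pos: "1 - \<rho>\<^sup>2 > 0"
    using assms by (auto simp: abs_square_less_1)
  let ?v = "sqrt ((1 - \<rho>\<^sup>2) / (1 + \<rho>\<^sup>2))" and ?w = "sqrt ((1 + \<rho>\<^sup>2) / (1 - \<rho>\<^sup>2))"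
  have vw: "?v > 0" "?w > 0"
    using pos by (auto simp: add_pos_nonneg)
  have "(\<integral>\<^sup>+p. (mehler \<rho> (fst p) (snd p))\<^sup>2 \<partial>std_normal2)
      = (\<integral>\<^sup>+x. \<integral>\<^sup>+y. (mehler \<rho> x y)\<^sup>2 \<partial>std_normal_distribution \<partial>std_normal_distribution)"
    by (subst std_normal.nn_integral_fst[symmetric]) simp_all
  also have "\<dots> = (\<integral>\<^sup>+x. \<integral>\<^sup>+y. ennreal (std_normal_density x * (std_normal_density y * (mehler \<rho> x y)\<^sup>2)) \<partial>lborel \<partial>lborel)"
    by (simp add: nn_integral_density ennreal_mult' nn_integral_cmult)
  also have "\<dots> = (\<integral>\<^sup>+x. ennreal (1 / (1 - \<rho>\<^sup>2) * normal_density 0 ?w x) \<partial>lborel)"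
    using pos vw unfolding mehler_square_density[OF assms]
    by (subst ennreal_mult') (simp_all add: nn_integral_cmult nn_integral_normal_density)
  also have "\<dots> = ennreal (1 / (1 - \<rho>\<^sup>2))"
    using pos vw by (subst ennreal_mult') (simp_all add: nn_integral_cmult nn_integral_normal_density)
  finally show ?thesis .
qed

lemma
  fixes f g :: "real \<Rightarrow> real"
  assumes f: "integrable std_normal_distribution f" and g: "integrable std_normal_distribution g"
  shows integrable_std_normal2_mult: "integrable std_normal2 (\<lambda>p. f (fst p) * g (snd p))"
    and integral_std_normal2_mult: "(LINT p|std_normal2. f (fst p) * g (snd p))
      = (LINT x|std_normal_distribution. f x) * (LINT x|std_normal_distribution. g x)"
proof -
  have [measurable]: "f \<in> borel_measurable borel" "g \<in> borel_measurable borel"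
    using borel_measurable_integrable[OF f] borel_measurable_integrable[OF g] by simp_all
  show i: "integrable std_normal2 (\<lambda>p. f (fst p) * g (snd p))"
    using f g by (intro std_normal2.Fubini_integrable) (simp_all add: abs_mult)
  show "(LINT p|std_normal2. f (fst p) * g (snd p))
      = (LINT x|std_normal_distribution. f x) * (LINT x|std_normal_distribution. g x)"
    by (subst std_normal2.integral_fst'[OF i, symmetric]) simp
qed

lemma
  assumes "\<bar>\<rho>\<bar> < 1"
  shows integrable_mehler_square: "integrable std_normal2 (\<lambda>p. (mehler \<rho> (fst p) (snd p))\<^sup>2)"
    and integral_mehler_square:
      "(LINT p|std_normal2. (mehler \<rho> (fst p) (snd p))\<^sup>2) = 1 / (1 - \<rho>\<^sup>2)"
proof -
  have "0 \<le> 1 / (1 - \<rho>\<^sup>2)"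
    using assms by (simp add: abs_square_le_1)
  with nn_integral_mehler_square[OF assms]
  have "has_bochner_integral std_normal2 (\<lambda>p. (mehler \<rho> (fst p) (snd p))\<^sup>2) (1 / (1 - \<rho>\<^sup>2))"
    by (intro has_bochner_integral_nn_integral) auto
  then show "integrable std_normal2 (\<lambda>p. (mehler \<rho> (fst p) (snd p))\<^sup>2)"
    and "(LINT p|std_normal2. (mehler \<rho> (fst p) (snd p))\<^sup>2) = 1 / (1 - \<rho>\<^sup>2)"
    by (auto simp: has_bochner_integral_iff)
qed

text \<open>The kernel and \<open>f (fst p) * g (snd p)\<close> are both square integrable under the
  product law, so their product is integrable. Fubini then integrates the second coordinate first,
  by \<open>integral_mehler\<close>.\<close>

lemma
  fixes f g :: "real \<Rightarrow> real"
  assumes [measurable]: "f \<in> borel_measurable borel" "g \<in> borel_measurable borel"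
    and f: "integrable std_normal_distribution (\<lambda>x. (f x)\<^sup>2)"
    and g: "integrable std_normal_distribution (\<lambda>x. (g x)\<^sup>2)" and \<rho>: "\<bar>\<rho>\<bar> < 1"
  shows integrable_mehler_mult:
      "integrable std_normal2 (\<lambda>p. mehler \<rho> (fst p) (snd p) * (f (fst p) * g (snd p)))"
    and integral_mehler_mult:
      "(LINT p|std_normal2. mehler \<rho> (fst p) (snd p) * (f (fst p) * g (snd p)))
        = (LINT x|std_normal_distribution. f x *
             (LINT z|std_normal_distribution. g (\<rho> * x + sqrt (1 - \<rho>\<^sup>2) * z)))"
proof -
  show i: "integrable std_normal2 (\<lambda>p. mehler \<rho> (fst p) (snd p) * (f (fst p) * g (snd p)))"
    using integrable_std_normal2_mult[OF f g] integrable_mehler_square[OF \<rho>]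
    by (intro integrable_mult_L2) (simp_all add: power_mult_distrib)
  show "(LINT p|std_normal2. mehler \<rho> (fst p) (snd p) * (f (fst p) * g (snd p)))
        = (LINT x|std_normal_distribution. f x *
             (LINT z|std_normal_distribution. g (\<rho> * x + sqrt (1 - \<rho>\<^sup>2) * z)))"
    by (subst std_normal2.integral_fst'[OF i, symmetric])
      (simp add: mult.left_commute[of _ "f _"] integral_mehler \<rho>)
qed

text \<open>Under the product measure the functions \<open>e j\<close> below are the terms of Mehler's expansion of the
  kernel; computing the norm of the remainder directly makes convergence of the expansion, and
  hence completeness of the Hermite polynomials, unnecessary.\<close>

lemma mehler_contraction:
  fixes f :: "real \<Rightarrow> real"
  assumes [measurable]: "f \<in> borel_measurable borel"
    and f: "integrable std_normal_distribution (\<lambda>x. (f x)\<^sup>2)"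
    and orth: "\<And>j. j < m \<Longrightarrow> (LINT x|std_normal_distribution. f x * poly (hermite j) x) = 0"
    and \<rho>: "\<bar>\<rho>\<bar> < 1"
  shows "\<bar>LINT x|std_normal_distribution. f x *
        (LINT z|std_normal_distribution. f (\<rho> * x + sqrt (1 - \<rho>\<^sup>2) * z))\<bar>
    \<le> \<bar>\<rho>\<bar> ^ m / sqrt (1 - \<rho>\<^sup>2) * (LINT x|std_normal_distribution. (f x)\<^sup>2)"
proof -
  let ?N = std_normal_distribution
  define M where "M = (\<lambda>p. mehler \<rho> (fst p) (snd p))"
  define F where "F = (\<lambda>p :: real \<times> real. f (fst p) * f (snd p))"
  define e where "e = (\<lambda>j p. \<rho> ^ j / fact j * (poly (hermite j) (fst p) * poly (hermite j) (snd p)))"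
  define K where "K = (\<lambda>p. M p - (\<Sum>j<m. e j p))"
  have pos: "1 - \<rho>\<^sup>2 > 0"
    using \<rho> by (simp add: abs_square_less_1)
  have [measurable]: "poly (hermite j) \<in> borel_measurable borel" for j
    by (intro borel_measurable_continuous_onI continuous_intros)
  have [measurable]: "M \<in> borel_measurable std_normal2" "F \<in> borel_measurable std_normal2"
    "e j \<in> borel_measurable std_normal2" "K \<in> borel_measurable std_normal2" for j
    unfolding M_def F_def e_def K_def by measurable
  have H2: "integrable ?N (\<lambda>x. (poly (hermite j) x)\<^sup>2)" for j
    using integrable_std_normal_poly_mult[of "hermite j" "hermite j"] by (simp add: power2_eq_square)
  \<comment> \<open>Each of the two Hermite factors of \<open>e j\<close> has squared norm
    \<open>fact j\<close>, which cancels the denominators.\<close>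
  have ee: "integrable std_normal2 (\<lambda>p. e j p * e k p)"
      "(LINT p|std_normal2. e j p * e k p) = (if j = k then \<rho> ^ (2 * j) else 0)" for j k
  proof -
    have eq: "e j p * e k p = \<rho> ^ j / fact j * (\<rho> ^ k / fact k) *
        (poly (hermite j) (fst p) * poly (hermite k) (fst p) *
         (poly (hermite j) (snd p) * poly (hermite k) (snd p)))" for p
      by (simp add: e_def)
    have "integrable ?N (\<lambda>x. poly (hermite j) x * poly (hermite k) x)"
      by simp
    note int = integrable_std_normal2_mult[OF this this] integral_std_normal2_mult[OF this this]
    show "integrable std_normal2 (\<lambda>p. e j p * e k p)"
      unfolding eq using int(1) by (intro integrable_mult_right) simp
    have "(LINT p|std_normal2. e j p * e k p) = \<rho> ^ j / fact j * (\<rho> ^ k / fact k) *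
        (LINT p|std_normal2. poly (hermite j) (fst p) * poly (hermite k) (fst p) *
         (poly (hermite j) (snd p) * poly (hermite k) (snd p)))"
      unfolding eq by (rule integral_mult_right_zero)
    then show "(LINT p|std_normal2. e j p * e k p) = (if j = k then \<rho> ^ (2 * j) else 0)"
      unfolding int(2) hermite_orthogonal by (simp add: power_add mult_2)
  qed
  \<comment> \<open>The inner product of the kernel with \<open>e j\<close> equals the squared norm
    of \<open>e j\<close>: the partial sum is the orthogonal projection of \<open>M\<close>, and
    \<open>K\<close> is the remainder.\<close>
  have Me: "integrable std_normal2 (\<lambda>p. M p * e j p)"
      "(LINT p|std_normal2. M p * e j p) = \<rho> ^ (2 * j)" for j
  proof -
    have eq: "M p * e j p = \<rho> ^ j / fact j *
        (mehler \<rho> (fst p) (snd p) * (poly (hermite j) (fst p) * poly (hermite j) (snd p)))" for p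
      by (simp add: e_def M_def)
    note int = integrable_mehler_mult[OF _ _ H2 H2 \<rho>] integral_mehler_mult[OF _ _ H2 H2 \<rho>]
    show "integrable std_normal2 (\<lambda>p. M p * e j p)"
      unfolding eq using int(1) by (intro integrable_mult_right) simp
    have "(LINT z|?N. poly (hermite j) (\<rho> * x + sqrt (1 - \<rho>\<^sup>2) * z)) = \<rho> ^ j * poly (hermite j) x" for x
      using pos by (intro hermite_mehler) simp
    then show "(LINT p|std_normal2. M p * e j p) = \<rho> ^ (2 * j)"
      unfolding eq using hermite_orthogonal[of j j]
      by (subst integral_mult_right_zero, subst int(2))
        (simp_all add: mult.left_commute power_add mult_2)
  qed
  have M2: "integrable std_normal2 (\<lambda>p. (M p)\<^sup>2)" "(LINT p|std_normal2. (M p)\<^sup>2) = 1 / (1 - \<rho>\<^sup>2)"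
    using integrable_mehler_square[OF \<rho>] integral_mehler_square[OF \<rho>] by (simp_all add: M_def)
  have K_eq: "(K p)\<^sup>2 = (M p)\<^sup>2 - 2 * (\<Sum>j<m. M p * e j p) + (\<Sum>j<m. \<Sum>k<m. e j p * e k p)" for p
    by (simp add: K_def power2_eq_square sum_distrib_left[symmetric] sum_distrib_right[symmetric] algebra_simps)
  have K2: "integrable std_normal2 (\<lambda>p. (K p)\<^sup>2)"
    unfolding K_eq using M2(1) Me(1) ee(1) by auto
  \<comment> \<open>The cross terms subtract the sum twice and the squares add it once; what remains
    of the geometric series is its tail from \<open>m\<close> on.\<close>
  have "(LINT p|std_normal2. (K p)\<^sup>2) = 1 / (1 - \<rho>\<^sup>2) - 2 * (\<Sum>j<m. \<rho> ^ (2 * j)) + (\<Sum>j<m. \<rho> ^ (2 * j))"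
    unfolding K_eq using M2 Me ee by (simp add: Bochner_Integration.integral_sum)
  also have "\<dots> = 1 / (1 - \<rho>\<^sup>2) - (1 - (\<rho>\<^sup>2) ^ m) / (1 - \<rho>\<^sup>2)"
    using pos by (simp add: power_mult sum_gp_strict)
  also have "\<dots> = (\<rho> ^ m)\<^sup>2 / (1 - \<rho>\<^sup>2)"
    by (simp add: diff_divide_distrib flip: power_mult) (simp add: mult.commute)
  finally have K2_eq: "(LINT p|std_normal2. (K p)\<^sup>2) = (\<rho> ^ m)\<^sup>2 / (1 - \<rho>\<^sup>2)" .
  have F2: "integrable std_normal2 (\<lambda>p. (F p)\<^sup>2)"
      "(LINT p|std_normal2. (F p)\<^sup>2) = (LINT x|?N. (f x)\<^sup>2)\<^sup>2"
    using integrable_std_normal2_mult[OF f f] integral_std_normal2_mult[OF f f]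
    by (simp_all add: F_def power_mult_distrib power2_eq_square[of "integral\<^sup>L _ _"])
  have fH: "integrable ?N (\<lambda>x. f x * poly (hermite j) x)" for j
    using f H2 by (intro integrable_mult_L2) simp_all
  have Fe: "integrable std_normal2 (\<lambda>p. F p * e j p)" "j < m \<Longrightarrow> (LINT p|std_normal2. F p * e j p) = 0" for j
  proof -
    have eq: "F p * e j p = \<rho> ^ j / fact j *
        (f (fst p) * poly (hermite j) (fst p) * (f (snd p) * poly (hermite j) (snd p)))" for p
      by (simp add: e_def F_def)
    note int = integrable_std_normal2_mult[OF fH fH] integral_std_normal2_mult[OF fH fH]
    show "integrable std_normal2 (\<lambda>p. F p * e j p)"
      unfolding eq using int(1) by (intro integrable_mult_right) simp
    show "j < m \<Longrightarrow> (LINT p|std_normal2. F p * e j p) = 0"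
      unfolding eq by (subst integral_mult_right_zero) (simp add: int(2) orth)
  qed
  have MF: "integrable std_normal2 (\<lambda>p. M p * F p)"
    using integrable_mehler_mult[OF _ _ f f \<rho>] by (simp add: M_def F_def)
  \<comment> \<open>As \<open>F\<close> is orthogonal to \<open>e j\<close> for
    \<open>j < m\<close>, replacing the kernel by its remainder does not change the quadratic
    form.\<close>
  have "(LINT p|std_normal2. F p * K p) = (LINT p|std_normal2. M p * F p - (\<Sum>j<m. F p * e j p))"
    by (simp add: K_def algebra_simps sum_distrib_left)
  also have "\<dots> = (LINT p|std_normal2. M p * F p)"
    using MF Fe by (simp add: Bochner_Integration.integral_sum)
  also have "\<dots> = (LINT x|?N. f x * (LINT z|?N. f (\<rho> * x + sqrt (1 - \<rho>\<^sup>2) * z)))"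
    using integral_mehler_mult[OF _ _ f f \<rho>] by (simp add: M_def F_def)
  finally have I: "(LINT p|std_normal2. F p * K p)
      = (LINT x|?N. f x * (LINT z|?N. f (\<rho> * x + sqrt (1 - \<rho>\<^sup>2) * z)))" .
  have "(LINT p|std_normal2. F p * K p)\<^sup>2 \<le> (LINT p|std_normal2. (F p)\<^sup>2) * (LINT p|std_normal2. (K p)\<^sup>2)"
    using F2(1) K2 by (intro integral_Cauchy_Schwarz) simp_all
  also have "\<dots> = (\<bar>\<rho>\<bar> ^ m / sqrt (1 - \<rho>\<^sup>2) * (LINT x|?N. (f x)\<^sup>2))\<^sup>2"
    using pos by (simp add: F2 K2_eq power_mult_distrib power_divide flip: power_abs)
  finally show ?thesis
    unfolding I by (rule abs_le_square_iff[THEN iffD2, THEN order_trans]) (use pos in simp)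
qed

section \<open>Independence from characteristic functions\<close>

lemma char_density:
  assumes [measurable]: "g \<in> borel_measurable M" "X \<in> borel_measurable M" and "\<And>x. 0 \<le> g x"
  shows "char (distr (density M g) borel X) t = (CLINT x|M. g x * iexp (t * X x))"
  unfolding char_def using assms(3)
  by (subst integral_distr) (auto simp: integral_density scaleR_conv_of_real)

text \<open>The bounded function \<open>g\<close> is shifted to a positive weight, so that uniqueness of
  characteristic functions applies to the law of \<open>V\<close> under the weighted measure. For
  \<open>indep_var_char\<close> this is used with \<open>g = cos (t * U)\<close> and \<open>g = sin (t * U)\<close>, and then again with
  \<open>g\<close> the indicator of an event in \<open>V\<close>.\<close>

lemma (in prob_space) expectation_weighted_eq:
  fixes g :: "'a \<Rightarrow> real" and V :: "'a \<Rightarrow> real"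
  assumes [measurable]: "random_variable borel g" "random_variable borel V" "A \<in> sets borel"
    and g: "\<And>\<omega>. \<bar>g \<omega>\<bar> \<le> 1"
    and ch: "\<And>s. (CLINT \<omega>|M. g \<omega> * iexp (s * V \<omega>)) = expectation g * (CLINT \<omega>|M. iexp (s * V \<omega>))"
  shows "expectation (\<lambda>\<omega>. g \<omega> * indicator A (V \<omega>)) = expectation g * prob (V -` A \<inter> space M)"
proof -
  \<comment> \<open>\<open>c\<close> is the mean of \<open>2 + g\<close>, so \<open>w\<close> is a
    probability density; the shift by 2 keeps \<open>c\<close> at least 1.\<close>
  define c where "c = 2 + expectation g"
  define w where "w = (\<lambda>\<omega>. (2 + g \<omega>) / c)"
  have ig: "integrable M g"
    using g by (intro integrable_const_bound[of _ 1]) auto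
  have "\<bar>expectation g\<bar> \<le> expectation (\<lambda>_. 1)"
    using g ig by (intro order_trans[OF integral_abs_bound] integral_mono) auto
  then have c: "c > 0"
    by (simp add: c_def prob_space)
  have [measurable]: "w \<in> borel_measurable M"
    unfolding w_def by measurable
  have w0: "0 \<le> w \<omega>" for \<omega>
    using g[of \<omega>] c by (auto simp: w_def)
  have iw: "integrable M w"
    using ig by (simp add: w_def)
  have w1: "expectation w = 1"
    using ig c by (simp add: w_def prob_space) (simp add: c_def)
  let ?D = "density M w"
  have pD: "prob_space ?D"
  proof
    have "emeasure ?D (space ?D) = (\<integral>\<^sup>+\<omega>. w \<omega> \<partial>M)"
      by (simp add: emeasure_density cong: nn_integral_cong)
    also have "\<dots> = 1"
      using nn_integral_eq_integral[OF iw] w0 w1 by simp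
    finally show "emeasure ?D (space ?D) = 1" .
  qed
  interpret D: prob_space ?D by fact
  have "distr ?D borel V = distr M borel V"
  proof (rule Levy_uniqueness)
    show "real_distribution (distr ?D borel V)"
      by (rule D.real_distribution_distr) simp
    show "real_distribution (distr M borel V)"
      by (rule real_distribution_distr) simp
    \<comment> \<open>By the hypothesis on \<open>g\<close> the weighted characteristic function is
      \<open>(2 + expectation g) / c\<close>, that is 1, times the unweighted one.\<close>
    show "char (distr ?D borel V) = char (distr M borel V)"
    proof
      fix s
      have i: "integrable M (\<lambda>\<omega>. iexp (s * V \<omega>))"
        by (rule integrable_iexp) auto
      have ig': "integrable M (\<lambda>\<omega>. complex_of_real (g \<omega>) * iexp (s * V \<omega>))"
        using g by (intro integrable_const_bound[of _ 1]) (auto simp: norm_mult simp del: of_real_mult)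
      have "char (distr ?D borel V) s = (CLINT \<omega>|M. w \<omega> * iexp (s * V \<omega>))"
        by (rule char_density) (auto simp: w0)
      also have "\<dots> = (CLINT \<omega>|M. (2 * iexp (s * V \<omega>) + g \<omega> * iexp (s * V \<omega>)) / c)"
        by (simp add: w_def add_divide_distrib algebra_simps)
      also have "\<dots> = (2 * (CLINT \<omega>|M. iexp (s * V \<omega>)) + expectation g * (CLINT \<omega>|M. iexp (s * V \<omega>))) / c"
        using i ig' by (simp add: ch del: of_real_mult)
      also have "\<dots> = c * (CLINT \<omega>|M. iexp (s * V \<omega>)) / c"
        by (simp add: c_def algebra_simps)
      also have "\<dots> = (CLINT \<omega>|M. iexp (s * V \<omega>))"
        using c by simp
      also have "\<dots> = char (distr M borel V) s"
        by (simp add: char_def integral_distr)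
      finally show "char (distr ?D borel V) s = char (distr M borel V) s" .
    qed
  qed
  then have "measure (distr ?D borel V) A = measure (distr M borel V) A"
    by simp
  then have 1: "measure ?D (V -` A \<inter> space M) = prob (V -` A \<inter> space M)"
    by (simp add: measure_distr)
  have iwA: "integrable M (\<lambda>\<omega>. w \<omega> * indicator A (V \<omega>))"
    using w0 by (intro Bochner_Integration.integrable_bound[OF iw]) (auto split: split_indicator)
  have "emeasure ?D (V -` A \<inter> space M) = (\<integral>\<^sup>+\<omega>. w \<omega> * indicator A (V \<omega>) \<partial>M)"
    by (subst emeasure_density) (auto intro!: nn_integral_cong split: split_indicator)
  also have "\<dots> = ennreal (expectation (\<lambda>\<omega>. w \<omega> * indicator A (V \<omega>)))"
    using nn_integral_eq_integral[OF iwA] w0 by simp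
  finally have 2: "measure ?D (V -` A \<inter> space M) = expectation (\<lambda>\<omega>. w \<omega> * indicator A (V \<omega>))"
    using w0 by (simp add: measure_def integral_nonneg_AE)
  have iA: "integrable M (\<lambda>\<omega>. indicator A (V \<omega>) :: real)"
    by (intro integrable_const_bound[of _ 1]) auto
  have igA: "integrable M (\<lambda>\<omega>. g \<omega> * indicator A (V \<omega>))"
    using g by (intro integrable_const_bound[of _ 1]) (auto split: split_indicator)
  have A: "expectation (\<lambda>\<omega>. indicator A (V \<omega>)) = prob (V -` A \<inter> space M)"
  proof -
    have "expectation (\<lambda>\<omega>. indicator A (V \<omega>) :: real) = expectation (indicator (V -` A \<inter> space M))"
      by (intro Bochner_Integration.integral_cong) (auto split: split_indicator)
    then show ?thesis by simp
  qed
  have "expectation (\<lambda>\<omega>. w \<omega> * indicator A (V \<omega>))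
      = expectation (\<lambda>\<omega>. (2 * indicator A (V \<omega>) + g \<omega> * indicator A (V \<omega>)) / c)"
    by (simp add: w_def algebra_simps)
  also have "\<dots> = (2 * prob (V -` A \<inter> space M) + expectation (\<lambda>\<omega>. g \<omega> * indicator A (V \<omega>))) / c"
    using iA igA A by simp
  finally show ?thesis
    using 1 2 c by (simp add: c_def field_simps)
qed

text \<open>Kac's theorem for two variables.\<close>

theorem (in prob_space) indep_var_char:
  fixes U V :: "'a \<Rightarrow> real"
  assumes [measurable]: "random_variable borel U" "random_variable borel V"
    and ch: "\<And>s t. (CLINT \<omega>|M. iexp (t * U \<omega>) * iexp (s * V \<omega>))
      = (CLINT \<omega>|M. iexp (t * U \<omega>)) * (CLINT \<omega>|M. iexp (s * V \<omega>))"
  shows "indep_var borel U borel V"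
proof -
  have int: "integrable M (\<lambda>\<omega>. iexp (t * U \<omega>))" for t
    by (rule integrable_iexp) auto
  have int2: "integrable M (\<lambda>\<omega>. iexp (t * U \<omega>) * iexp (s * V \<omega>))" for s t
    by (intro integrable_const_bound[of _ 1]) (auto simp: norm_mult simp del: of_real_mult)
  \<comment> \<open>Cosine and sine are combinations of the exponentials at \<open>t\<close> and
    \<open>- t\<close>, at both of which the product formula holds.\<close>
  have cos_eq: "complex_of_real (cos x) = (iexp x + iexp (- x)) / 2" for x
    by (simp add: complex_eq_iff Re_exp Im_exp)
  have sin_eq: "complex_of_real (sin x) = (iexp x - iexp (- x)) / (2 * \<i>)" for x
    by (simp add: complex_eq_iff Re_exp Im_exp)
  have cosU: "complex_of_real (expectation (\<lambda>\<omega>. cos (t * U \<omega>)))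
      = ((CLINT \<omega>|M. iexp (t * U \<omega>)) + (CLINT \<omega>|M. iexp ((-t) * U \<omega>))) / 2" for t
    using int[of t] int[of "-t"] by (simp add: cos_eq flip: integral_complex_of_real)
  have sinU: "complex_of_real (expectation (\<lambda>\<omega>. sin (t * U \<omega>)))
      = ((CLINT \<omega>|M. iexp (t * U \<omega>)) - (CLINT \<omega>|M. iexp ((-t) * U \<omega>))) / (2 * \<i>)" for t
    using int[of t] int[of "-t"] by (simp add: sin_eq flip: integral_complex_of_real)
  have chcos: "(CLINT \<omega>|M. complex_of_real (cos (t * U \<omega>)) * iexp (s * V \<omega>))
      = complex_of_real (expectation (\<lambda>\<omega>. cos (t * U \<omega>))) * (CLINT \<omega>|M. iexp (s * V \<omega>))" for s t
  proof -
    have "(CLINT \<omega>|M. complex_of_real (cos (t * U \<omega>)) * iexp (s * V \<omega>)) =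
      (CLINT \<omega>|M. (iexp (t * U \<omega>) * iexp (s * V \<omega>) + iexp ((-t) * U \<omega>) * iexp (s * V \<omega>)) / 2)"
      unfolding cos_eq by (simp add: algebra_simps add_divide_distrib)
    also have "\<dots> = ((CLINT \<omega>|M. iexp (t * U \<omega>) * iexp (s * V \<omega>))
        + (CLINT \<omega>|M. iexp ((-t) * U \<omega>) * iexp (s * V \<omega>))) / 2"
      by (subst integral_divide_zero, subst Bochner_Integration.integral_add) (use int2 in blast)+
    finally show ?thesis
      unfolding ch cosU by (simp add: algebra_simps add_divide_distrib)
  qed
  have chsin: "(CLINT \<omega>|M. complex_of_real (sin (t * U \<omega>)) * iexp (s * V \<omega>))
      = complex_of_real (expectation (\<lambda>\<omega>. sin (t * U \<omega>))) * (CLINT \<omega>|M. iexp (s * V \<omega>))" for s t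
  proof -
    have "(CLINT \<omega>|M. complex_of_real (sin (t * U \<omega>)) * iexp (s * V \<omega>)) =
      (CLINT \<omega>|M. (iexp (t * U \<omega>) * iexp (s * V \<omega>) - iexp ((-t) * U \<omega>) * iexp (s * V \<omega>)) / (2 * \<i>))"
      unfolding sin_eq by (simp add: algebra_simps diff_divide_distrib)
    also have "\<dots> = ((CLINT \<omega>|M. iexp (t * U \<omega>) * iexp (s * V \<omega>))
        - (CLINT \<omega>|M. iexp ((-t) * U \<omega>) * iexp (s * V \<omega>))) / (2 * \<i>)"
      by (subst integral_divide_zero, subst Bochner_Integration.integral_diff) (use int2 in blast)+
    finally show ?thesis
      unfolding ch sinU by (simp add: algebra_simps diff_divide_distrib)
  qed
  have trig: "expectation (\<lambda>\<omega>. cos (t * U \<omega>) * indicator B (V \<omega>))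
        = expectation (\<lambda>\<omega>. cos (t * U \<omega>)) * prob (V -` B \<inter> space M)"
      "expectation (\<lambda>\<omega>. sin (t * U \<omega>) * indicator B (V \<omega>))
        = expectation (\<lambda>\<omega>. sin (t * U \<omega>)) * prob (V -` B \<inter> space M)"
    if [measurable]: "B \<in> sets borel" for t B
    by (rule expectation_weighted_eq; (fact chcos chsin | simp))+
  \<comment> \<open>With cosine and sine recombined, the hypothesis of
    \<open>expectation_weighted_eq\<close> holds with the roles of \<open>U\<close> and
    \<open>V\<close> exchanged.\<close>
  have swap: "(CLINT \<omega>|M. complex_of_real (indicator B (V \<omega>)) * iexp (t * U \<omega>))
      = complex_of_real (expectation (\<lambda>\<omega>. indicator B (V \<omega>))) * (CLINT \<omega>|M. iexp (t * U \<omega>))"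
    if [measurable]: "B \<in> sets borel" for t B
  proof -
    have B: "expectation (\<lambda>\<omega>. indicator B (V \<omega>)) = prob (V -` B \<inter> space M)"
    proof -
      have "expectation (\<lambda>\<omega>. indicator B (V \<omega>) :: real) = expectation (indicator (V -` B \<inter> space M))"
        by (intro Bochner_Integration.integral_cong) (auto split: split_indicator)
      then show ?thesis by simp
    qed
    have e: "iexp x = complex_of_real (cos x) + \<i> * complex_of_real (sin x)" for x
      by (simp add: complex_eq_iff Re_exp Im_exp)
    have i: "integrable M (\<lambda>\<omega>. cos (t * U \<omega>))" "integrable M (\<lambda>\<omega>. sin (t * U \<omega>))"
      "integrable M (\<lambda>\<omega>. cos (t * U \<omega>) * indicator B (V \<omega>))"
      "integrable M (\<lambda>\<omega>. sin (t * U \<omega>) * indicator B (V \<omega>))"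
      by (intro integrable_const_bound[of _ 1]; auto split: split_indicator)+
    have "(CLINT \<omega>|M. complex_of_real (indicator B (V \<omega>)) * iexp (t * U \<omega>))
       = (CLINT \<omega>|M. complex_of_real (cos (t * U \<omega>) * indicator B (V \<omega>))
           + \<i> * complex_of_real (sin (t * U \<omega>) * indicator B (V \<omega>)))"
      unfolding e by (simp add: algebra_simps)
    also have "\<dots> = complex_of_real (expectation (\<lambda>\<omega>. cos (t * U \<omega>) * indicator B (V \<omega>)))
        + \<i> * complex_of_real (expectation (\<lambda>\<omega>. sin (t * U \<omega>) * indicator B (V \<omega>)))"
      using i(3,4) by (simp del: of_real_mult)
    also have "\<dots> = complex_of_real (prob (V -` B \<inter> space M)) *
       (complex_of_real (expectation (\<lambda>\<omega>. cos (t * U \<omega>))) + \<i> * complex_of_real (expectation (\<lambda>\<omega>. sin (t * U \<omega>))))"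
      unfolding trig[OF that] by (simp add: algebra_simps)
    also have "complex_of_real (expectation (\<lambda>\<omega>. cos (t * U \<omega>))) + \<i> * complex_of_real (expectation (\<lambda>\<omega>. sin (t * U \<omega>)))
       = (CLINT \<omega>|M. iexp (t * U \<omega>))"
      unfolding e using i(1,2) by (simp del: of_real_mult)
    finally show ?thesis
      by (simp add: B)
  qed
  have ind: "prob ((U -` A \<inter> space M) \<inter> (V -` B \<inter> space M))
      = prob (U -` A \<inter> space M) * prob (V -` B \<inter> space M)"
    if A[measurable]: "A \<in> sets borel" and B[measurable]: "B \<in> sets borel" for A B
  proof -
    have "expectation (\<lambda>\<omega>. indicator B (V \<omega>) * indicator A (U \<omega>))
        = expectation (\<lambda>\<omega>. indicator B (V \<omega>)) * prob (U -` A \<inter> space M)"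
      by (rule expectation_weighted_eq) (use swap[OF B] in \<open>auto split: split_indicator\<close>)
    moreover have "expectation (\<lambda>\<omega>. indicator B (V \<omega>) * indicator A (U \<omega>) :: real)
        = expectation (indicator ((U -` A \<inter> space M) \<inter> (V -` B \<inter> space M)))"
      by (intro Bochner_Integration.integral_cong) (auto split: split_indicator)
    moreover have "expectation (\<lambda>\<omega>. indicator B (V \<omega>) :: real) = expectation (indicator (V -` B \<inter> space M))"
      by (intro Bochner_Integration.integral_cong) (auto split: split_indicator)
    ultimately show ?thesis
      by simp
  qed
  have "distr M borel U \<Otimes>\<^sub>M distr M borel V = distr M (borel \<Otimes>\<^sub>M borel) (\<lambda>\<omega>. (U \<omega>, V \<omega>))"
  proof -
    interpret U: prob_space "distr M borel U" by (rule prob_space_distr) simp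
    interpret V: prob_space "distr M borel V" by (rule prob_space_distr) simp
    show ?thesis
    proof (rule pair_measure_eqI)
      fix A B assume "A \<in> sets (distr M borel U)" "B \<in> sets (distr M borel V)"
      then have [measurable]: "A \<in> sets borel" "B \<in> sets borel" by simp_all
      have "(\<lambda>\<omega>. (U \<omega>, V \<omega>)) -` (A \<times> B) \<inter> space M = (U -` A \<inter> space M) \<inter> (V -` B \<inter> space M)"
        by auto
      then show "emeasure (distr M borel U) A * emeasure (distr M borel V) B
          = emeasure (distr M (borel \<Otimes>\<^sub>M borel) (\<lambda>\<omega>. (U \<omega>, V \<omega>))) (A \<times> B)"
        using ind[of A B] by (simp add: emeasure_distr emeasure_eq_measure ennreal_mult')
    qed (auto simp: U.sigma_finite_measure_axioms V.sigma_finite_measure_axioms cong: sets_pair_measure_cong)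
  qed
  then show ?thesis
    by (simp add: indep_var_distribution_eq)
qed

section \<open>Covariances and block means of functions of a Gaussian sequence\<close>

lemma (in prob_space) gaussian_rv_integrable:
  assumes "gaussian_rv M X"
  shows "integrable M X" "integrable M (\<lambda>\<omega>. (X \<omega>)\<^sup>2)"
proof -
  have [measurable]: "random_variable borel X"
    using assms by (simp add: gaussian_rv_def)
  consider \<mu> \<sigma> where "\<sigma> > 0" "distributed M lborel X (normal_density \<mu> \<sigma>)" | \<mu> where "AE \<omega> in M. X \<omega> = \<mu>"
    using assms by (auto simp: gaussian_rv_def)
  then have "integrable M X \<and> integrable M (\<lambda>\<omega>. (X \<omega>)\<^sup>2)"
  proof cases
    case 1
    note D = distributed_integrable[OF 1(2), symmetric]
    have 1: "integrable lborel (\<lambda>x. normal_density \<mu> \<sigma> x * x)"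
      using 1(1) by (rule integrable_normal_moment_nz_1)
    \<comment> \<open>The second moment is expanded around \<open>\<mu>\<close>, since the moments
      of a normal density are given in central form.\<close>
    have "integrable lborel (\<lambda>x. normal_density \<mu> \<sigma> x * (x - \<mu>)\<^sup>2 + 2 * \<mu> * (normal_density \<mu> \<sigma> x * x) - \<mu>\<^sup>2 * normal_density \<mu> \<sigma> x)"
      using 1 integrable_normal_moment[of \<sigma> \<mu> 2] \<open>\<sigma> > 0\<close> by simp
    also have "(\<lambda>x. normal_density \<mu> \<sigma> x * (x - \<mu>)\<^sup>2 + 2 * \<mu> * (normal_density \<mu> \<sigma> x * x) - \<mu>\<^sup>2 * normal_density \<mu> \<sigma> x)
        = (\<lambda>x. normal_density \<mu> \<sigma> x * x\<^sup>2)"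
      by (simp add: fun_eq_iff power2_eq_square algebra_simps)
    finally show ?thesis
      using 1 D[of "\<lambda>x. x"] D[of "\<lambda>x. x\<^sup>2"] by simp
  next
    case 2
    have "integrable M (\<lambda>\<omega>. X \<omega>) \<longleftrightarrow> integrable M (\<lambda>\<omega>. \<mu>)"
      "integrable M (\<lambda>\<omega>. (X \<omega>)\<^sup>2) \<longleftrightarrow> integrable M (\<lambda>\<omega>. \<mu>\<^sup>2)"
      by (intro integrable_cong_AE; use 2 in auto)+
    then show ?thesis by simp
  qed
  then show "integrable M X" "integrable M (\<lambda>\<omega>. (X \<omega>)\<^sup>2)" by auto
qed

lemma (in prob_space) distr_std_normal:
  assumes "distributed M lborel X std_normal_density"
  shows "distr M borel X = std_normal_distribution"
  using assms by (simp add: distributed_def cong: distr_cong)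

text \<open>Written through the second moment, one formula covers both alternatives of
  \<open>gaussian_rv\<close>: a degenerate variable with mean zero is almost surely 0 and has second
  moment 0.\<close>

lemma (in prob_space) gaussian_rv_char:
  assumes "gaussian_rv M X" and 0: "expectation X = 0"
  shows "(CLINT \<omega>|M. iexp (X \<omega>)) = complex_of_real (exp (- expectation (\<lambda>\<omega>. (X \<omega>)\<^sup>2) / 2))"
proof -
  have [measurable]: "random_variable borel X"
    using assms by (simp add: gaussian_rv_def)
  consider \<mu> \<sigma> where "\<sigma> > 0" "distributed M lborel X (normal_density \<mu> \<sigma>)" | \<mu> where "AE \<omega> in M. X \<omega> = \<mu>"
    using assms by (auto simp: gaussian_rv_def)
  then show ?thesis
  proof cases
    case 1
    then have "\<mu> = 0" and v: "expectation (\<lambda>\<omega>. (X \<omega>)\<^sup>2) = \<sigma>\<^sup>2"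
      using normal_distributed_expectation[OF 1] normal_distributed_variance[OF 1] 0 by auto
    then have "distr M borel (\<lambda>\<omega>. X \<omega> / \<sigma>) = std_normal_distribution"
      using 1 normal_standard_normal_convert[OF 1(1), of X \<mu>] by (intro distr_std_normal) simp
    \<comment> \<open>The frequency \<open>\<sigma>\<close> undoes the scaling of
      \<open>X \<omega> / \<sigma>\<close>.\<close>
    then have "char std_normal_distribution \<sigma> = char (distr M borel (\<lambda>\<omega>. X \<omega> / \<sigma>)) \<sigma>"
      by simp
    also have "\<dots> = (CLINT \<omega>|M. iexp (X \<omega>))"
      using 1(1) by (simp add: char_def integral_distr)
    finally show ?thesis
      by (simp add: char_std_normal_distribution v)
  next
    case 2
    have "expectation X = expectation (\<lambda>_. \<mu>)"
      by (intro integral_cong_AE) (use 2 in auto)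
    then have "\<mu> = 0"
      using 0 by (simp add: prob_space)
    then have X: "AE \<omega> in M. X \<omega> = 0"
      using 2 by simp
    have "(CLINT \<omega>|M. iexp (X \<omega>)) = (CLINT \<omega>|M. 1)"
      by (intro integral_cong_AE) (use X in auto)
    moreover have "expectation (\<lambda>\<omega>. (X \<omega>)\<^sup>2) = expectation (\<lambda>_. 0)"
      by (intro integral_cong_AE) (use X in auto)
    ultimately show ?thesis
      by (simp add: prob_space)
  qed
qed

section \<open>Pair laws of a stationary Gaussian sequence\<close>

locale standard_gaussian_sequence = prob_space +
  fixes Z :: "nat \<Rightarrow> 'a \<Rightarrow> real"
  assumes gaussian: "gaussian_sequence M Z"
    and stationary: "stationary_sequence M Z"
    and mean_zero: "\<And>t. expectation (Z t) = 0"
    and unit_variance: "\<And>t. variance (Z t) = 1"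
begin

lemma gaussian_combination: "gaussian_rv M (\<lambda>\<omega>. a * Z i \<omega> + b * Z j \<omega>)" if "i \<noteq> j"
proof -
  have "gaussian_rv M (\<lambda>\<omega>. \<Sum>k\<in>{i, j}. (if k = i then a else b) * Z k \<omega>)"
    by (rule gaussian[unfolded gaussian_sequence_def, rule_format]) simp
  then show ?thesis
    using that by simp
qed

lemma gaussian_rv: "gaussian_rv M (Z t)"
  using gaussian_combination[of t "Suc t" 1 0] by simp

lemma measurable_Z [measurable]: "Z t \<in> borel_measurable M"
  using gaussian_rv by (simp add: gaussian_rv_def)

lemma integrable_Z [simp]: "integrable M (Z t)" "integrable M (\<lambda>\<omega>. (Z t \<omega>)\<^sup>2)"
  using gaussian_rv_integrable[OF gaussian_rv] by auto

lemma integrable_Z_mult [simp]: "integrable M (\<lambda>\<omega>. Z i \<omega> * Z j \<omega>)"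
  by (rule integrable_mult_L2) simp_all

lemma second_moment [simp]: "expectation (\<lambda>\<omega>. (Z t \<omega>)\<^sup>2) = 1"
  using unit_variance[of t] by (simp add: mean_zero)

lemma distr_Z: "distr M borel (Z t) = std_normal_distribution"
proof -
  consider \<mu> \<sigma> where "\<sigma> > 0" "distributed M lborel (Z t) (normal_density \<mu> \<sigma>)" | \<mu> where "AE \<omega> in M. Z t \<omega> = \<mu>"
    using gaussian_rv[of t] by (auto simp: gaussian_rv_def)
  then show ?thesis
  proof cases
    case 1
    then have "\<mu> = 0" "\<sigma>\<^sup>2 = 1"
      using normal_distributed_expectation[OF 1] normal_distributed_variance[OF 1]
        mean_zero unit_variance by auto
    then have "\<sigma> = 1"
      using 1(1) by (simp add: power2_eq_1_iff)
    then show ?thesis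
      using 1 \<open>\<mu> = 0\<close> by (simp add: distr_std_normal)
  next
    case 2
    \<comment> \<open>A constant with mean zero vanishes, which contradicts the unit second
      moment.\<close>
    have "expectation (Z t) = expectation (\<lambda>_. \<mu>)"
      by (intro integral_cong_AE) (use 2 in auto)
    then have "AE \<omega> in M. Z t \<omega> = 0"
      using 2 by (simp add: mean_zero prob_space)
    then have "expectation (\<lambda>\<omega>. (Z t \<omega>)\<^sup>2) = expectation (\<lambda>_. 0)"
      by (intro integral_cong_AE) auto
    then show ?thesis by simp
  qed
qed

lemma
  fixes f :: "real \<Rightarrow> real"
  assumes [measurable]: "f \<in> borel_measurable borel"
  shows integrable_Z_iff: "integrable M (\<lambda>\<omega>. f (Z t \<omega>)) \<longleftrightarrow> integrable std_normal_distribution f"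
    and expectation_Z: "expectation (\<lambda>\<omega>. f (Z t \<omega>)) = (LINT x|std_normal_distribution. f x)"
  unfolding distr_Z[of t, symmetric] by (simp_all add: integrable_distr_eq integral_distr)

definition autocov :: "nat \<Rightarrow> real" where
  "autocov k = expectation (\<lambda>\<omega>. Z 0 \<omega> * Z k \<omega>)"

text \<open>Stationarity is an equality of laws on sequence space, so both expectations are
  integrals of the functional \<open>x 0 * x k\<close> against the same law.\<close>

lemma autocov_shift: "expectation (\<lambda>\<omega>. Z h \<omega> * Z (h + k) \<omega>) = autocov k"
proof -
  let ?P = "\<Pi>\<^sub>M i\<in>UNIV. (borel :: real measure)"
  have m: "(\<lambda>\<omega> i. Z (i + h) \<omega>) \<in> measurable M ?P" for h
    by (rule measurable_PiM_single') auto
  have c: "(\<lambda>x. x 0 * x k) \<in> borel_measurable ?P"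
    by (intro borel_measurable_times measurable_component_singleton) auto
  have "expectation (\<lambda>\<omega>. Z h \<omega> * Z (h + k) \<omega>) = (LINT x|distr M ?P (\<lambda>\<omega> i. Z (i + h) \<omega>). x 0 * x k)"
    by (subst integral_distr[OF m c]) (simp add: add.commute)
  moreover have "distr M ?P (\<lambda>\<omega> i. Z (i + h) \<omega>) = distr M ?P (\<lambda>\<omega> i. Z (i + 0) \<omega>)"
    using stationary by (simp add: stationary_sequence_def)
  moreover have "(LINT x|distr M ?P (\<lambda>\<omega> i. Z (i + 0) \<omega>). x 0 * x k) = autocov k"
    by (subst integral_distr[OF m c]) (simp add: autocov_def)
  ultimately show ?thesis
    by simp
qed

lemma char_pair:
  assumes "i \<noteq> j"
  shows "(CLINT \<omega>|M. iexp (a * Z i \<omega> + b * Z j \<omega>))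
    = complex_of_real (exp (- (a\<^sup>2 + b\<^sup>2 + 2 * a * b * expectation (\<lambda>\<omega>. Z i \<omega> * Z j \<omega>)) / 2))"
proof -
  have "expectation (\<lambda>\<omega>. (a * Z i \<omega> + b * Z j \<omega>)\<^sup>2)
      = expectation (\<lambda>\<omega>. a\<^sup>2 * (Z i \<omega>)\<^sup>2 + b\<^sup>2 * (Z j \<omega>)\<^sup>2 + 2 * a * b * (Z i \<omega> * Z j \<omega>))"
    by (simp add: power2_eq_square algebra_simps)
  also have "\<dots> = a\<^sup>2 + b\<^sup>2 + 2 * a * b * expectation (\<lambda>\<omega>. Z i \<omega> * Z j \<omega>)"
    by simp
  finally show ?thesis
    by (subst gaussian_rv_char[OF gaussian_combination[OF assms]]) (simp_all add: mean_zero)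
qed

text \<open>Gaussian regression: the residual of \<open>Z j\<close> on \<open>Z i\<close> is
  uncorrelated with \<open>Z i\<close>. Since all linear combinations are Gaussian, the joint
  characteristic function of \<open>Z i\<close> and the scaled residual factorises, and
  \<open>indep_var_char\<close> gives independence.\<close>

lemma distr_regression:
  assumes "i \<noteq> j" and \<rho>: "\<rho> = expectation (\<lambda>\<omega>. Z i \<omega> * Z j \<omega>)" "\<bar>\<rho>\<bar> < 1"
  shows "distr M std_normal2 (\<lambda>\<omega>. (Z i \<omega>, (Z j \<omega> - \<rho> * Z i \<omega>) / sqrt (1 - \<rho>\<^sup>2))) = std_normal2"
proof -
  define s where "s = sqrt (1 - \<rho>\<^sup>2)"
  have s: "s > 0" "s\<^sup>2 = 1 - \<rho>\<^sup>2"
    using \<rho>(2) by (simp_all add: s_def abs_square_less_1 abs_square_le_1)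
  define R where "R = (\<lambda>\<omega>. (Z j \<omega> - \<rho> * Z i \<omega>) / s)"
  have [measurable]: "R \<in> borel_measurable M"
    unfolding R_def by measurable
  have joint: "(CLINT \<omega>|M. iexp (t * Z i \<omega> + u * R \<omega>)) = complex_of_real (exp (- (t\<^sup>2 + u\<^sup>2) / 2))" for t u
  proof -
    have "(CLINT \<omega>|M. iexp (t * Z i \<omega> + u * R \<omega>))
        = (CLINT \<omega>|M. iexp ((t - u * \<rho> / s) * Z i \<omega> + u / s * Z j \<omega>))"
      by (intro Bochner_Integration.integral_cong refl arg_cong[where f = "\<lambda>x. iexp x"])
        (simp add: R_def diff_divide_distrib algebra_simps)
    also have "\<dots> = complex_of_real (exp (- ((t - u * \<rho> / s)\<^sup>2 + (u / s)\<^sup>2 + 2 * (t - u * \<rho> / s) * (u / s) * \<rho>) / 2))"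
      unfolding char_pair[OF assms(1)] \<rho>(1)[symmetric] ..
    \<comment> \<open>The terms in \<open>t * u\<close> cancel because \<open>\<rho>\<close> is the
      covariance.\<close>
    also have "(t - u * \<rho> / s)\<^sup>2 + (u / s)\<^sup>2 + 2 * (t - u * \<rho> / s) * (u / s) * \<rho>
        = t\<^sup>2 + (u / s)\<^sup>2 * (1 - \<rho>\<^sup>2)"
      by (simp add: power2_eq_square algebra_simps add_divide_distrib diff_divide_distrib)
    also have "(u / s)\<^sup>2 * (1 - \<rho>\<^sup>2) = u\<^sup>2"
      unfolding s(2)[symmetric] using s(1) by (simp add: power_divide)
    finally show ?thesis .
  qed
  have charZ: "(CLINT \<omega>|M. iexp (t * Z i \<omega>)) = complex_of_real (exp (- t\<^sup>2 / 2))" for t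
    using joint[of t 0] by simp
  have charR: "(CLINT \<omega>|M. iexp (u * R \<omega>)) = complex_of_real (exp (- u\<^sup>2 / 2))" for u
    using joint[of 0 u] by simp
  have "distr M borel R = std_normal_distribution"
  proof (rule Levy_uniqueness)
    show "real_distribution (distr M borel R)"
      by (rule real_distribution_distr) simp
    show "char (distr M borel R) = char std_normal_distribution"
      by (simp add: char_def[of "distr M borel R"] integral_distr charR char_std_normal_distribution fun_eq_iff
          del: of_real_mult)
  qed (rule real_dist_normal_dist)
  moreover have "indep_var borel (Z i) borel R"
  proof (rule indep_var_char)
    fix u t
    have "(CLINT \<omega>|M. iexp (t * Z i \<omega>) * iexp (u * R \<omega>)) = (CLINT \<omega>|M. iexp (t * Z i \<omega> + u * R \<omega>))"
      by (simp add: exp_add algebra_simps)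
    also have "\<dots> = (CLINT \<omega>|M. iexp (t * Z i \<omega>)) * (CLINT \<omega>|M. iexp (u * R \<omega>))"
      unfolding joint charZ charR by (simp add: add_divide_distrib diff_divide_distrib flip: of_real_mult exp_add)
    finally show "(CLINT \<omega>|M. iexp (t * Z i \<omega>) * iexp (u * R \<omega>))
      = (CLINT \<omega>|M. iexp (t * Z i \<omega>)) * (CLINT \<omega>|M. iexp (u * R \<omega>))" .
  qed simp_all
  ultimately have "std_normal2 = distr M (borel \<Otimes>\<^sub>M borel) (\<lambda>\<omega>. (Z i \<omega>, R \<omega>))"
    by (simp add: indep_var_distribution_eq distr_Z)
  then show ?thesis
    by (simp add: R_def s_def cong: distr_cong)
qed

text \<open>Writing \<open>Z j\<close> as \<open>\<rho> * Z i\<close> plus \<open>s\<close> times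
  the independent standard normal residual of \<open>distr_regression\<close> turns the covariance
  into the quadratic form bounded by \<open>mehler_contraction\<close>.\<close>

lemma covariance_hermite_rank:
  fixes f :: "real \<Rightarrow> real"
  assumes [measurable]: "f \<in> borel_measurable borel"
    and f: "integrable std_normal_distribution (\<lambda>x. (f x)\<^sup>2)"
    and orth: "\<And>j. j < m \<Longrightarrow> (LINT x|std_normal_distribution. f x * poly (hermite j) x) = 0"
    and "i \<noteq> j" and \<rho>: "\<rho> = expectation (\<lambda>\<omega>. Z i \<omega> * Z j \<omega>)" "\<bar>\<rho>\<bar> < 1"
  shows "\<bar>expectation (\<lambda>\<omega>. f (Z i \<omega>) * f (Z j \<omega>))\<bar>
    \<le> \<bar>\<rho>\<bar> ^ m / sqrt (1 - \<rho>\<^sup>2) * (LINT x|std_normal_distribution. (f x)\<^sup>2)"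
proof -
  define s where "s = sqrt (1 - \<rho>\<^sup>2)"
  define R where "R = (\<lambda>\<omega>. (Z i \<omega>, (Z j \<omega> - \<rho> * Z i \<omega>) / s))"
  let ?g = "\<lambda>p. f (fst p) * f (\<rho> * fst p + s * snd p)"
  have s: "s > 0"
    using \<rho>(2) by (simp add: s_def abs_square_less_1)
  have R[measurable]: "R \<in> measurable M std_normal2"
    by (simp add: R_def)
  have g: "?g (R \<omega>) = f (Z i \<omega>) * f (Z j \<omega>)" for \<omega>
    using s by (simp add: R_def)
  have d: "distr M std_normal2 R = std_normal2"
    unfolding R_def s_def by (rule distr_regression) fact+
  have "integrable M (\<lambda>\<omega>. f (Z i \<omega>) * f (Z j \<omega>))"
    using f integrable_Z_iff[of "\<lambda>x. (f x)\<^sup>2"] by (intro integrable_mult_L2) simp_all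
  then have "integrable (distr M std_normal2 R) ?g"
    by (subst integrable_distr_eq) (simp_all add: g)
  then have int: "integrable std_normal2 ?g"
    unfolding d .
  have "expectation (\<lambda>\<omega>. f (Z i \<omega>) * f (Z j \<omega>)) = (LINT p|distr M std_normal2 R. ?g p)"
    by (subst integral_distr) (simp_all add: g)
  also have "\<dots> = (LINT p|std_normal2. ?g p)"
    unfolding d ..
  also have "\<dots> = (LINT x|std_normal_distribution. f x *
        (LINT z|std_normal_distribution. f (\<rho> * x + s * z)))"
    by (subst std_normal2.integral_fst'[OF int, symmetric]) simp
  finally show ?thesis
    using mehler_contraction[OF assms(1) f orth \<rho>(2)] by (simp add: s_def)
qed

end

section \<open>Sums of covariances and second moments of block means\<close>

lemma sum_powr_minus_le:
  fixes \<beta> :: real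
  assumes "0 < \<beta>" "\<beta> < 1"
  shows "(\<Sum>n=1..l. real n powr (-\<beta>)) \<le> real l powr (1 - \<beta>) / (1 - \<beta>)"
proof (induction l)
  case (Suc l)
  \<comment> \<open>Comparison with the integral of \<open>z powr (-\<beta>)\<close>, summed by
    telescoping. The mean value theorem needs a positive left endpoint; at \<open>l = 0\<close> the
    subtracted power is 0 and the claim is direct.\<close>
  have "(1 - \<beta>) * real (Suc l) powr (-\<beta>) \<le> real (Suc l) powr (1 - \<beta>) - real l powr (1 - \<beta>)"
  proof (cases "l = 0")
    case False
    have "\<exists>z. real l < z \<and> z < real (Suc l) \<and> real (Suc l) powr (1 - \<beta>) - real l powr (1 - \<beta>)
        = (real (Suc l) - real l) * ((1 - \<beta>) * z powr (1 - \<beta> - 1))"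
    proof (rule MVT2)
      fix z assume "real l \<le> z" "z \<le> real (Suc l)"
      then have "z > 0"
        using False by simp
      then show "((\<lambda>z. z powr (1 - \<beta>)) has_real_derivative (1 - \<beta>) * z powr (1 - \<beta> - 1)) (at z)"
        by (rule has_real_derivative_powr)
    qed simp
    then obtain z where z: "real l < z" "z < real (Suc l)"
      "real (Suc l) powr (1 - \<beta>) - real l powr (1 - \<beta>) = (1 - \<beta>) * z powr (- \<beta>)"
      by auto
    have "real (Suc l) powr (-\<beta>) \<le> z powr (-\<beta>)"
      using z assms by (intro powr_mono2') auto
    then show ?thesis
      unfolding z(3) using assms by (intro mult_left_mono) auto
  qed (use assms in simp)
  then have "real (Suc l) powr (-\<beta>) \<le> (real (Suc l) powr (1 - \<beta>) - real l powr (1 - \<beta>)) / (1 - \<beta>)"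
    using assms by (simp add: pos_le_divide_eq mult.commute)
  then show ?case
    using Suc by (simp add: diff_divide_distrib)
qed simp

text \<open>Within the window every positive distance from \<open>j\<close> occurs at most once on
  each side, whence the factor 2. Both sides are reindexed by distance and then enlarged to all
  distances up to \<open>l\<close>.\<close>

lemma sum_off_diagonal_le:
  fixes g :: "nat \<Rightarrow> real"
  assumes g: "\<And>n. 0 \<le> g n" and c: "\<And>k. c j (j + k) \<le> g k" "\<And>k. k \<le> j \<Longrightarrow> c j (j - k) \<le> g k"
    and j: "j \<in> {i..i + l - 1}" and "1 \<le> l"
  shows "(\<Sum>k=i..i + l - 1. c j k) \<le> g 0 + 2 * (\<Sum>n=1..l. g n)"
proof -
  have J: "{i..i + l - 1} = insert j ({i..<j} \<union> {j<..i + l - 1})"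
    using j by auto
  have "(\<Sum>k\<in>{i..<j}. c j k) \<le> (\<Sum>k\<in>{i..<j}. g (j - k))"
    using c(2)[of "j - _"] by (intro sum_mono) (metis atLeastLessThan_iff diff_diff_cancel diff_le_self less_imp_le)
  also have "\<dots> = (\<Sum>n\<in>(\<lambda>k. j - k) ` {i..<j}. g n)"
    by (subst sum.reindex) (auto simp: inj_on_def)
  also have "\<dots> \<le> (\<Sum>n=1..l. g n)"
    using g j by (intro sum_mono2) auto
  finally have 1: "(\<Sum>k\<in>{i..<j}. c j k) \<le> (\<Sum>n=1..l. g n)" .
  have "(\<Sum>k\<in>{j<..i + l - 1}. c j k) \<le> (\<Sum>k\<in>{j<..i + l - 1}. g (k - j))"
    using c(1) by (intro sum_mono) (metis greaterThanAtMost_iff le_add_diff_inverse less_imp_le)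
  also have "\<dots> = (\<Sum>n\<in>(\<lambda>k. k - j) ` {j<..i + l - 1}. g n)"
    by (subst sum.reindex) (auto simp: inj_on_def)
  also have "\<dots> \<le> (\<Sum>n=1..l. g n)"
    using g j by (intro sum_mono2) auto
  finally have 2: "(\<Sum>k\<in>{j<..i + l - 1}. c j k) \<le> (\<Sum>n=1..l. g n)" .
  have "(\<Sum>k=i..i + l - 1. c j k) = c j j + ((\<Sum>k\<in>{i..<j}. c j k) + (\<Sum>k\<in>{j<..i + l - 1}. c j k))"
    unfolding J by (subst sum.insert, simp, simp, subst sum.union_disjoint) auto
  then show ?thesis
    using 1 2 c(1)[of 0] by simp
qed

context standard_gaussian_sequence
begin

lemma integrable_Z_L2_mult:
  fixes f :: "real \<Rightarrow> real"
  assumes [measurable]: "f \<in> borel_measurable borel"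
    and f: "integrable std_normal_distribution (\<lambda>x. (f x)\<^sup>2)"
  shows "integrable M (\<lambda>\<omega>. f (Z i \<omega>) * f (Z j \<omega>))"
  using f integrable_Z_iff[of "\<lambda>x. (f x)\<^sup>2"] by (intro integrable_mult_L2) simp_all

text \<open>Covers the finitely many lags at which the correlation may be too close to 1 in absolute
  value for \<open>covariance_hermite_rank\<close> to be useful.\<close>

lemma covariance_le_second_moment:
  fixes f :: "real \<Rightarrow> real"
  assumes [measurable]: "f \<in> borel_measurable borel"
    and f: "integrable std_normal_distribution (\<lambda>x. (f x)\<^sup>2)"
  shows "\<bar>expectation (\<lambda>\<omega>. f (Z i \<omega>) * f (Z j \<omega>))\<bar> \<le> (LINT x|std_normal_distribution. (f x)\<^sup>2)"
proof -
  have "(expectation (\<lambda>\<omega>. f (Z i \<omega>) * f (Z j \<omega>)))\<^sup>2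
      \<le> expectation (\<lambda>\<omega>. (f (Z i \<omega>))\<^sup>2) * expectation (\<lambda>\<omega>. (f (Z j \<omega>))\<^sup>2)"
    using f integrable_Z_iff[of "\<lambda>x. (f x)\<^sup>2"] by (intro integral_Cauchy_Schwarz) simp_all
  also have "\<dots> = (LINT x|std_normal_distribution. (f x)\<^sup>2)\<^sup>2"
    using expectation_Z[of "\<lambda>x. (f x)\<^sup>2"] by (simp add: power2_eq_square[of "integral\<^sup>L _ _"])
  finally show ?thesis
    by (rule abs_le_square_iff[THEN iffD2, THEN order_trans]) simp
qed

text \<open>\<open>D\<close> is chosen before \<open>f\<close>, because one constant has to serve
  \<open>G\<close> and the whole family \<open>h v\<close> of Condition-I. This is possible since
  the contraction bound depends on \<open>f\<close> only through its second moment.\<close>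

lemma covariance_decay:
  assumes r: "autocov \<in> O(\<lambda>k. real k powr (- \<alpha>))" and \<alpha>: "0 < \<alpha>"
  shows "\<exists>D\<ge>0. \<forall>f\<in>borel_measurable borel. integrable std_normal_distribution (\<lambda>x. (f x)\<^sup>2) \<longrightarrow>
      (\<forall>j<m. (LINT x|std_normal_distribution. f x * poly (hermite j) x) = 0) \<longrightarrow>
      (\<forall>i. \<forall>k\<ge>1. \<bar>expectation (\<lambda>\<omega>. f (Z i \<omega>) * f (Z (i + k) \<omega>))\<bar>
          \<le> D * real k powr (- (\<alpha> * real m)) * (LINT x|std_normal_distribution. (f x)\<^sup>2))"
proof -
  obtain c where c: "c > 0" "\<forall>\<^sub>F k in sequentially. norm (autocov k) \<le> c * norm (real k powr (- \<alpha>))"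
    using r by (elim landau_o.bigE)
  have "((\<lambda>k. c * real k powr (- \<alpha>)) \<longlongrightarrow> c * 0) sequentially"
    using \<alpha> by (intro tendsto_mult tendsto_const tendsto_neg_powr filterlim_real_sequentially) auto
  then have "\<forall>\<^sub>F k in sequentially. c * real k powr (- \<alpha>) < 1 / 2"
    by (rule order_tendstoD) simp
  with c(2) have "\<forall>\<^sub>F k in sequentially. \<bar>autocov k\<bar> \<le> c * real k powr (- \<alpha>) \<and> \<bar>autocov k\<bar> \<le> 1 / 2"
    by eventually_elim auto
  then obtain K where K: "\<And>k. k \<ge> K \<Longrightarrow> \<bar>autocov k\<bar> \<le> c * real k powr (- \<alpha>)" "\<And>k. k \<ge> K \<Longrightarrow> \<bar>autocov k\<bar> \<le> 1 / 2"
    unfolding eventually_sequentially by blast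
  let ?\<beta> = "\<alpha> * real m"
  show ?thesis
  \<comment> \<open>\<open>2 * c ^ m\<close> serves the lags from \<open>K\<close> on, where the
    square root in the denominator is at least 1/2. \<open>real K powr ?\<beta>\<close> serves the
    shorter lags, where it lifts the bound above the second moment.\<close>
  proof (intro exI[of _ "2 * c ^ m + real K powr ?\<beta>"] conjI ballI impI allI)
    show "0 \<le> 2 * c ^ m + real K powr ?\<beta>"
      using c by simp
    fix f :: "real \<Rightarrow> real" and i k :: nat
    assume f: "f \<in> borel_measurable borel" "integrable std_normal_distribution (\<lambda>x. (f x)\<^sup>2)"
      and orth: "\<forall>j<m. (LINT x|std_normal_distribution. f x * poly (hermite j) x) = 0" and k: "1 \<le> k"
    let ?v = "LINT x|std_normal_distribution. (f x)\<^sup>2"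
    let ?E = "expectation (\<lambda>\<omega>. f (Z i \<omega>) * f (Z (i + k) \<omega>))"
    have v: "0 \<le> ?v" by simp
    show "\<bar>?E\<bar> \<le> (2 * c ^ m + real K powr ?\<beta>) * real k powr (- ?\<beta>) * ?v"
    proof (cases "k \<ge> K")
      case True
      define \<rho> where "\<rho> = autocov k"
      have \<rho>: "\<bar>\<rho>\<bar> \<le> c * real k powr (- \<alpha>)" "\<bar>\<rho>\<bar> \<le> 1 / 2"
        using K True by (auto simp: \<rho>_def)
      have "\<bar>\<rho>\<bar>\<^sup>2 \<le> (1 / 2)\<^sup>2"
        using \<rho>(2) by (intro power_mono) auto
      then have "sqrt ((1 / 2)\<^sup>2) \<le> sqrt (1 - \<rho>\<^sup>2)"
        by (intro real_sqrt_le_mono) (simp add: power2_eq_square)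
      then have s: "1 / 2 \<le> sqrt (1 - \<rho>\<^sup>2)"
        by (simp del: real_sqrt_le_iff)
      have "\<bar>?E\<bar> \<le> \<bar>\<rho>\<bar> ^ m / sqrt (1 - \<rho>\<^sup>2) * ?v"
        using k \<rho>(2) by (intro covariance_hermite_rank f orth[rule_format]) (auto simp: \<rho>_def autocov_shift)
      also have "\<dots> \<le> \<bar>\<rho>\<bar> ^ m / (1 / 2) * ?v"
        using s by (intro mult_right_mono v divide_left_mono mult_pos_pos) (linarith | simp)+
      also have "\<dots> \<le> (c * real k powr (- \<alpha>)) ^ m / (1 / 2) * ?v"
        using \<rho>(1) by (intro mult_right_mono v divide_right_mono power_mono) auto
      also have "\<dots> = 2 * c ^ m * real k powr (- ?\<beta>) * ?v"
        using k by (simp add: power_mult_distrib powr_power mult.commute)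
      also have "\<dots> \<le> (2 * c ^ m + real K powr ?\<beta>) * real k powr (- ?\<beta>) * ?v"
        by (intro mult_right_mono v) auto
      finally show ?thesis .
    next
      case False
      have "1 = real k powr ?\<beta> * real k powr (- ?\<beta>)"
        using k by (simp flip: powr_add)
      also have "\<dots> \<le> (2 * c ^ m + real K powr ?\<beta>) * real k powr (- ?\<beta>)"
        using False \<alpha> c k by (intro mult_right_mono add_increasing powr_mono2) auto
      finally have "1 * ?v \<le> (2 * c ^ m + real K powr ?\<beta>) * real k powr (- ?\<beta>) * ?v"
        by (intro mult_right_mono v)
      then show ?thesis
        using covariance_le_second_moment[OF f, of i "i + k"] by linarith
    qed
  qed
qed

text \<open>A row of the covariance matrix of a block sums to order
  \<open>real l powr (1 - \<beta>)\<close>; there are \<open>l\<close> rows, and division by the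
  square of \<open>real l\<close> leaves \<open>real l powr (- \<beta>)\<close>.\<close>

lemma block_mean_second_moment:
  fixes f :: "real \<Rightarrow> real"
  assumes f: "f \<in> borel_measurable borel" "integrable std_normal_distribution (\<lambda>x. (f x)\<^sup>2)"
    and D: "0 \<le> D" "\<And>i k. 1 \<le> k \<Longrightarrow> \<bar>expectation (\<lambda>\<omega>. f (Z i \<omega>) * f (Z (i + k) \<omega>))\<bar>
          \<le> D * real k powr (- \<beta>) * (LINT x|std_normal_distribution. (f x)\<^sup>2)"
    and \<beta>: "0 < \<beta>" "\<beta> < 1" and l: "1 \<le> l"
  shows "integrable M (\<lambda>\<omega>. (block_mean l (\<lambda>t. f (Z t \<omega>)) i)\<^sup>2)" (is ?int)
    and "expectation (\<lambda>\<omega>. (block_mean l (\<lambda>t. f (Z t \<omega>)) i)\<^sup>2)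
      \<le> (1 + 2 * D / (1 - \<beta>)) * real l powr (- \<beta>) * (LINT x|std_normal_distribution. (f x)\<^sup>2)" (is "?E \<le> _")
proof -
  let ?v = "LINT x|std_normal_distribution. (f x)\<^sup>2"
  let ?J = "{i..i + l - 1}"
  let ?c = "\<lambda>j k. expectation (\<lambda>\<omega>. f (Z j \<omega>) * f (Z k \<omega>))"
  \<comment> \<open>Lag 0 is listed separately because \<open>0 powr (- \<beta>)\<close> is
    0.\<close>
  let ?g = "\<lambda>n. if n = 0 then ?v else D * real n powr (- \<beta>) * ?v"
  have v: "0 \<le> ?v" by simp
  have eq: "(block_mean l (\<lambda>t. f (Z t \<omega>)) i)\<^sup>2 = (\<Sum>j\<in>?J. \<Sum>k\<in>?J. f (Z j \<omega>) * f (Z k \<omega>)) / (real l)\<^sup>2" for \<omega>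
    unfolding block_mean_def power_divide by (simp add: power2_eq_square sum_product)
  note int = integrable_Z_L2_mult[OF f]
  show ?int
    unfolding eq using int by auto
  have c: "?c j (j + k) \<le> ?g k" for j k
    using D(2)[of k j] covariance_le_second_moment[OF f, of j j] by (cases "k = 0") auto
  have c': "?c j (j - k) \<le> ?g k" if "k \<le> j" for j k
    using c[of "j - k" k] that by (simp add: mult.commute cong: if_cong)
  have "(\<Sum>n=1..l. ?g n) = D * ?v * (\<Sum>n=1..l. real n powr (- \<beta>))"
    unfolding sum_distrib_left by (intro sum.cong) auto
  also have "\<dots> \<le> D * ?v * (real l powr (1 - \<beta>) / (1 - \<beta>))"
    using sum_powr_minus_le[OF \<beta>] D(1) v by (intro mult_left_mono) auto
  finally have g: "(\<Sum>n=1..l. ?g n) \<le> D * ?v * (real l powr (1 - \<beta>) / (1 - \<beta>))" .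
  have l1: "1 \<le> real l powr (1 - \<beta>)"
    using l \<beta> by (simp add: ge_one_powr_ge_zero)
  have "(\<Sum>j\<in>?J. \<Sum>k\<in>?J. ?c j k) \<le> (\<Sum>j\<in>?J. ?g 0 + 2 * (\<Sum>n=1..l. ?g n))"
    using c c' D(1) v l by (intro sum_mono sum_off_diagonal_le) auto
  also have "\<dots> \<le> (\<Sum>j\<in>?J. ?v * real l powr (1 - \<beta>) + 2 * (D * ?v * (real l powr (1 - \<beta>) / (1 - \<beta>))))"
    using g mult_left_mono[OF l1 v] by (intro sum_mono) simp
  also have "\<dots> = real l * (real l powr (1 - \<beta>) * ((1 + 2 * D / (1 - \<beta>)) * ?v))"
    using l by (simp add: algebra_simps)
  also have "real l powr (1 - \<beta>) = real l * real l powr (- \<beta>)"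
    using l powr_add[of "real l" 1 "- \<beta>"] by simp
  finally have *: "(\<Sum>j\<in>?J. \<Sum>k\<in>?J. ?c j k) \<le> (real l)\<^sup>2 * ((1 + 2 * D / (1 - \<beta>)) * real l powr (- \<beta>) * ?v)"
    by (simp add: power2_eq_square ac_simps)
  have "?E = (\<Sum>j\<in>?J. \<Sum>k\<in>?J. ?c j k) / (real l)\<^sup>2"
    unfolding eq using int by (simp add: Bochner_Integration.integral_sum)
  also have "\<dots> \<le> (1 + 2 * D / (1 - \<beta>)) * real l powr (- \<beta>) * ?v"
    using * l by (simp add: pos_divide_le_eq mult.commute)
  finally show "?E \<le> (1 + 2 * D / (1 - \<beta>)) * real l powr (- \<beta>) * ?v" .
qed

end

section \<open>Perturbation of block variances\<close>

text \<open>Both estimators are \<open>real l powr \<beta>\<close> times this quantity for their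
  block means, so one argument treats both schemes. At \<open>N = 0\<close> the value is 0, in
  agreement with \<open>V_NOL\<close> for \<open>n < l\<close>.\<close>

definition emp_var :: "nat \<Rightarrow> (nat \<Rightarrow> real) \<Rightarrow> real" where
  "emp_var N b = (\<Sum>i=1..N. (b i - (\<Sum>k=1..N. b k) / real N)\<^sup>2) / real N"

lemma V_OL_eq_emp_var: "V_OL n l \<beta> x = real l powr \<beta> * emp_var (n - l + 1) (block_mean l x)"
  unfolding V_OL_def emp_var_def Let_def by (simp only: sum_distrib_left times_divide_eq_right)

lemma V_NOL_eq_emp_var:
  "V_NOL n l \<beta> x = real l powr \<beta> * emp_var (n div l) (\<lambda>i. block_mean l x (1 + (i - 1) * l))"
  by (simp add: V_NOL_def emp_var_def Let_def sum_distrib_left)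

lemma emp_var_nonneg: "0 \<le> emp_var N b"
  by (simp add: emp_var_def sum_nonneg)

lemma emp_var_le: "emp_var N b \<le> (\<Sum>i=1..N. (b i)\<^sup>2) / real N"
proof (cases "N = 0")
  case False
  define a where "a = (\<Sum>k=1..N. b k) / real N"
  have a: "(\<Sum>k=1..N. b k) = real N * a"
    using False by (simp add: a_def)
  have "(\<Sum>i=1..N. (b i - a)\<^sup>2) = (\<Sum>i=1..N. (b i)\<^sup>2) - 2 * a * (\<Sum>i=1..N. b i) + real N * a\<^sup>2"
    by (simp add: power2_diff sum.distrib sum_subtractf sum_distrib_left algebra_simps)
  also have "\<dots> = (\<Sum>i=1..N. (b i)\<^sup>2) - real N * a\<^sup>2"
    unfolding a by (simp add: power2_eq_square)
  also have "\<dots> \<le> (\<Sum>i=1..N. (b i)\<^sup>2)"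
    by simp
  finally show ?thesis
    unfolding emp_var_def a_def[symmetric] by (rule divide_right_mono) simp
qed (simp add: emp_var_def)

text \<open>Centring is linear and removes \<open>u\<close>; what remains is the expansion of a
  square, with Cauchy-Schwarz for the cross term.\<close>

lemma emp_var_perturbation:
  assumes b': "\<And>i. i \<in> {1..N} \<Longrightarrow> b' i = b i + u - e i"
  shows "\<bar>emp_var N b' - emp_var N b\<bar> \<le> emp_var N e + 2 * sqrt (emp_var N b * emp_var N e)"
proof (cases "N = 0")
  case False
  define p where "p = (\<lambda>i. b i - (\<Sum>k=1..N. b k) / real N)"
  define q where "q = (\<lambda>i. e i - (\<Sum>k=1..N. e k) / real N)"
  have "b' i - (\<Sum>k=1..N. b' k) / real N = p i - q i" if "i \<in> {1..N}" for i
    using False that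
    by (simp add: b' p_def q_def sum.distrib sum_subtractf add_divide_distrib diff_divide_distrib)
  then have "(\<Sum>i=1..N. (b' i - (\<Sum>k=1..N. b' k) / real N)\<^sup>2) = (\<Sum>i=1..N. (p i - q i)\<^sup>2)"
    by (intro sum.cong) auto
  also have "\<dots> = (\<Sum>i=1..N. (p i)\<^sup>2) + (\<Sum>i=1..N. (q i)\<^sup>2) - 2 * (\<Sum>i=1..N. p i * q i)"
    by (simp add: power2_diff sum.distrib sum_subtractf sum_distrib_left mult.assoc)
  finally have eq: "emp_var N b' - emp_var N b = emp_var N e - 2 * ((\<Sum>i=1..N. p i * q i) / real N)"
    unfolding emp_var_def[of N b'] unfolding emp_var_def[of N b] emp_var_def[of N e] p_def[symmetric] q_def[symmetric]
    by (simp add: emp_var_def p_def q_def add_divide_distrib diff_divide_distrib)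
  have "((\<Sum>i=1..N. p i * q i) / real N)\<^sup>2 \<le> (\<Sum>i=1..N. (p i)\<^sup>2) * (\<Sum>i=1..N. (q i)\<^sup>2) / (real N)\<^sup>2"
    unfolding power_divide by (intro divide_right_mono Cauchy_Schwarz_ineq_sum) simp
  also have "\<dots> = emp_var N b * emp_var N e"
    by (simp add: emp_var_def p_def q_def power2_eq_square)
  finally have "\<bar>(\<Sum>i=1..N. p i * q i) / real N\<bar> \<le> sqrt (emp_var N b * emp_var N e)"
    by (rule real_le_rsqrt[of "\<bar>_\<bar>", simplified])
  then show ?thesis
    unfolding eq using emp_var_nonneg[of N e] by linarith
qed (simp add: emp_var_def)

text \<open>Condition-I averages over the indices 1 to \<open>k\<close>, whereas a block starts at
  \<open>i\<close>; the shift \<open>i + j - 1\<close> matches the two.\<close>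

lemma block_mean_shift:
  assumes "1 \<le> l" "1 \<le> i"
  shows "(\<Sum>j=1..l. x (i + j - 1)) / real l = block_mean l x i"
proof -
  have "(\<Sum>j=1..l. x (i + j - 1)) = (\<Sum>j=i..i + l - 1. x j)"
    using assms by (intro sum.reindex_bij_witness[where i = "\<lambda>j. j + 1 - i" and j = "\<lambda>j. i + j - 1"]) auto
  then show ?thesis
    by (simp add: block_mean_def)
qed

text \<open>The deterministic part of the argument, at one outcome where four random quantities are
  bounded: \<open>K\<^sub>1\<close> and \<open>K\<^sub>2\<close> belong to \<open>W\<close> and
  \<open>U2\<close>, \<open>K\<^sub>3\<close> to the oracle block means, \<open>K\<^sub>4\<close> to
  the integrated squared block means of \<open>h\<close>.\<close>

lemma emp_var_block_perturbation:
  fixes \<beta> :: real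
  assumes b': "\<And>i. i \<in> {1..N} \<Longrightarrow> b' i = b i + u - e i"
    and e: "\<And>i. i \<in> {1..N} \<Longrightarrow> \<bar>e i\<bar> \<le> \<bar>w\<bar> + \<bar>u'\<bar> * sqrt (q i)" and q: "\<And>i. 0 \<le> q i"
    and w: "\<bar>w\<bar> \<le> K\<^sub>1 * real n powr (- \<beta>)" and u': "\<bar>u'\<bar> \<le> K\<^sub>2 * real n powr (- \<beta> / 2)"
    and b: "real l powr \<beta> * ((\<Sum>i=1..N. (b i)\<^sup>2) / real N) \<le> K\<^sub>3"
    and qb: "real l powr \<beta> * ((\<Sum>i=1..N. q i) / real N) \<le> K\<^sub>4"
    and l: "1 \<le> l" "l \<le> n" and \<beta>: "0 < \<beta>"
    and K: "0 \<le> K\<^sub>3" "0 \<le> K\<^sub>4" "K\<^sub>5 = 2 * K\<^sub>1\<^sup>2 + 2 * K\<^sub>2\<^sup>2 * K\<^sub>4"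
  shows "\<bar>real l powr \<beta> * emp_var N b' - real l powr \<beta> * emp_var N b\<bar>
    \<le> (K\<^sub>5 + 2 * sqrt (K\<^sub>3 * K\<^sub>5)) * (real l / real n) powr (\<beta> / 2)"
proof -
  let ?L = "real l powr \<beta>" and ?r = "(real l / real n) powr (\<beta> / 2)"
  have n: "real n > 0" "1 \<le> real n" and l0: "real l > 0" "real l / real n \<le> 1"
    using l by auto
  have r: "0 < ?r" "?r \<le> 1"
    using n l0 \<beta> by (auto intro!: powr_le1)
  have r2: "?r\<^sup>2 = ?L * real n powr (- \<beta>)"
  proof -
    have "?r\<^sup>2 = (real l / real n) powr \<beta>"
      by (simp add: power2_eq_square flip: powr_add)
    also have "\<dots> = ?L / real n powr \<beta>"
      by (rule powr_divide)
    finally show ?thesis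
      by (simp add: powr_minus_divide)
  qed
  \<comment> \<open>The square of \<open>w\<close> carries two factors
    \<open>real n powr (- \<beta>)\<close>; this bound gives one of them away, since the target rate
    asks for one.\<close>
  have nb: "real n powr (- \<beta>) \<le> 1"
    using powr_mono[OF _ n(2), of "- \<beta>" 0] n(1) \<beta> by (simp only: powr_zero_eq_one) simp
  have L: "1 \<le> ?L"
    using l \<beta> by (simp add: ge_one_powr_ge_zero)
  have K5: "0 \<le> K\<^sub>5"
    using K by simp
  have w2: "w\<^sup>2 \<le> K\<^sub>1\<^sup>2 * real n powr (- \<beta>)"
  proof -
    have "w\<^sup>2 \<le> (K\<^sub>1 * real n powr (- \<beta>))\<^sup>2"
      using power_mono[OF w, of 2] by simp
    also have "\<dots> = K\<^sub>1\<^sup>2 * real n powr (- \<beta>) * real n powr (- \<beta>)"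
      by (simp add: power2_eq_square)
    also have "\<dots> \<le> K\<^sub>1\<^sup>2 * real n powr (- \<beta>) * 1"
      using nb by (intro mult_left_mono) auto
    finally show ?thesis by simp
  qed
  have u2: "u'\<^sup>2 \<le> K\<^sub>2\<^sup>2 * real n powr (- \<beta>)"
  proof -
    have "u'\<^sup>2 \<le> (K\<^sub>2 * real n powr (- \<beta> / 2))\<^sup>2"
      using power_mono[OF u', of 2] by simp
    also have "\<dots> = K\<^sub>2\<^sup>2 * real n powr (- \<beta>)"
      using n by (simp add: power_mult_distrib powr_power)
    finally show ?thesis .
  qed
  have e2: "(e i)\<^sup>2 \<le> 2 * w\<^sup>2 + 2 * u'\<^sup>2 * q i" if "i \<in> {1..N}" for i
  proof -
    have "(e i)\<^sup>2 \<le> (\<bar>w\<bar> + \<bar>u'\<bar> * sqrt (q i))\<^sup>2"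
      using power_mono[OF e[OF that], of 2] by simp
    also have "\<dots> \<le> 2 * \<bar>w\<bar>\<^sup>2 + 2 * (\<bar>u'\<bar> * sqrt (q i))\<^sup>2"
      using sum_squares_bound[of "\<bar>w\<bar>" "\<bar>u'\<bar> * sqrt (q i)"] by (simp add: power2_sum)
    finally show ?thesis
      using q by (simp add: power_mult_distrib)
  qed
  have "(\<Sum>i=1..N. (e i)\<^sup>2) / real N \<le> (\<Sum>i=1..N. 2 * w\<^sup>2 + 2 * u'\<^sup>2 * q i) / real N"
    using e2 by (intro divide_right_mono sum_mono) auto
  also have "\<dots> \<le> 2 * w\<^sup>2 + 2 * u'\<^sup>2 * ((\<Sum>i=1..N. q i) / real N)"
    by (cases "N = 0") (simp_all add: sum.distrib sum_distrib_left add_divide_distrib)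
  finally have "?L * emp_var N e \<le> ?L * (2 * w\<^sup>2 + 2 * u'\<^sup>2 * ((\<Sum>i=1..N. q i) / real N))"
    using emp_var_le[of N e] by (intro mult_left_mono) auto
  also have "\<dots> = 2 * (?L * w\<^sup>2) + 2 * (u'\<^sup>2 * (?L * ((\<Sum>i=1..N. q i) / real N)))"
    by (simp add: algebra_simps)
  also have "\<dots> \<le> 2 * (?L * (K\<^sub>1\<^sup>2 * real n powr (- \<beta>))) + 2 * (K\<^sub>2\<^sup>2 * real n powr (- \<beta>) * K\<^sub>4)"
    using w2 u2 qb q K by (intro add_mono mult_left_mono mult_mono mult_nonneg_nonneg divide_nonneg_nonneg sum_nonneg) auto
  \<comment> \<open>The second term is of the smaller order \<open>real n powr (- \<beta>)\<close>;
    as \<open>1 \<le> ?L\<close>, it can be enlarged to the order of the first.\<close>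
  also have "\<dots> \<le> 2 * (?L * (K\<^sub>1\<^sup>2 * real n powr (- \<beta>))) + 2 * (?L * (K\<^sub>2\<^sup>2 * real n powr (- \<beta>) * K\<^sub>4))"
    using mult_right_mono[OF L, of "K\<^sub>2\<^sup>2 * real n powr (- \<beta>) * K\<^sub>4"] K by simp
  also have "\<dots> = K\<^sub>5 * ?r\<^sup>2"
    unfolding r2 K(3) by (simp add: algebra_simps)
  finally have ve: "?L * emp_var N e \<le> K\<^sub>5 * ?r\<^sup>2" .
  have vb: "?L * emp_var N b \<le> K\<^sub>3"
    using b mult_left_mono[OF emp_var_le[of N b], of ?L] by simp
  have prod: "(?L * emp_var N b) * (?L * emp_var N e) \<le> K\<^sub>3 * (K\<^sub>5 * ?r\<^sup>2)"
    by (rule mult_mono[OF vb ve K(1)]) (simp add: emp_var_nonneg)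
  have "\<bar>?L * emp_var N b' - ?L * emp_var N b\<bar> = ?L * \<bar>emp_var N b' - emp_var N b\<bar>"
    by (simp add: abs_mult flip: right_diff_distrib)
  also have "\<dots> \<le> ?L * (emp_var N e + 2 * sqrt (emp_var N b * emp_var N e))"
    by (intro mult_left_mono emp_var_perturbation[OF b']) auto
  also have "\<dots> = ?L * emp_var N e + 2 * sqrt ((?L * emp_var N b) * (?L * emp_var N e))"
    by (simp add: real_sqrt_mult algebra_simps)
  also have "\<dots> \<le> K\<^sub>5 * ?r\<^sup>2 + 2 * sqrt (K\<^sub>3 * (K\<^sub>5 * ?r\<^sup>2))"
    by (intro add_mono mult_left_mono real_sqrt_le_mono ve prod) simp
  also have "\<dots> = K\<^sub>5 * ?r\<^sup>2 + 2 * sqrt (K\<^sub>3 * K\<^sub>5) * ?r"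
    using r by (simp add: real_sqrt_mult)
  \<comment> \<open>The cross term is linear in \<open>?r\<close> and decides the order; the
    quadratic term is absorbed because \<open>?r\<close> is at most 1.\<close>
  also have "K\<^sub>5 * ?r\<^sup>2 \<le> K\<^sub>5 * ?r"
    using r K5 by (intro mult_left_mono) (auto simp: power2_eq_square mult_left_le)
  finally show ?thesis
    by (simp add: algebra_simps)
qed

section \<open>From expectation bounds to tail bounds\<close>

lemma (in prob_space) Markov_tail:
  fixes X :: "'a \<Rightarrow> real"
  assumes "integrable M X" "\<And>\<omega>. 0 \<le> X \<omega>" "expectation X \<le> B" "0 < \<epsilon>" "0 < B"
  shows "{\<omega>\<in>space M. X \<omega> > B / \<epsilon>} \<in> sets M" (is "?S \<in> _")
    and "prob {\<omega>\<in>space M. X \<omega> > B / \<epsilon>} \<le> \<epsilon>"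
proof -
  have [measurable]: "X \<in> borel_measurable M"
    using assms(1) by simp
  show "?S \<in> sets M"
    by measurable
  have "prob {\<omega>\<in>space M. X \<omega> > B / \<epsilon>} \<le> prob {\<omega>\<in>space M. X \<omega> \<ge> B / \<epsilon>}"
    by (intro finite_measure_mono) auto
  also have "\<dots> \<le> expectation X / (B / \<epsilon>)"
    using assms by (intro integral_Markov_inequality_measure[where A = "{}"]) auto
  also have "\<dots> \<le> \<epsilon>"
    using assms by (simp add: field_simps)
  finally show "prob ?S \<le> \<epsilon>" .
qed

text \<open>Fubini for a nonnegative integrand over a finite measure. The almost sure integrability
  supplies the premise under which Condition-I imposes its inequality.\<close>

lemma (in prob_space) integral_of_bounded_means:
  fixes \<phi> :: "'b \<Rightarrow> 'a \<Rightarrow> real"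
  assumes "finite_measure \<mu>"
    and [measurable]: "(\<lambda>(v, \<omega>). \<phi> v \<omega>) \<in> borel_measurable (\<mu> \<Otimes>\<^sub>M M)"
    and nonneg: "\<And>v \<omega>. 0 \<le> \<phi> v \<omega>"
    and int: "\<And>v. v \<in> space \<mu> \<Longrightarrow> integrable M (\<phi> v)"
    and L: "\<And>v. v \<in> space \<mu> \<Longrightarrow> expectation (\<phi> v) \<le> L"
  shows "AE \<omega> in M. integrable \<mu> (\<lambda>v. \<phi> v \<omega>)"
    and "integrable M (\<lambda>\<omega>. LINT v|\<mu>. \<phi> v \<omega>)"
    and "expectation (\<lambda>\<omega>. LINT v|\<mu>. \<phi> v \<omega>) \<le> L * measure \<mu> (space \<mu>)"
proof -
  interpret \<mu>: finite_measure \<mu> by fact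
  interpret P: pair_sigma_finite \<mu> M ..
  have i1: "integrable \<mu> (\<lambda>v. expectation (\<phi> v))"
    using L nonneg by (intro \<mu>.integrable_const_bound[of _ L] AE_I2) auto
  have i: "integrable (\<mu> \<Otimes>\<^sub>M M) (\<lambda>(v, \<omega>). \<phi> v \<omega>)"
    using i1 int nonneg by (intro P.Fubini_integrable) auto
  show "AE \<omega> in M. integrable \<mu> (\<lambda>v. \<phi> v \<omega>)"
    by (rule P.AE_integrable_snd[OF i])
  show "integrable M (\<lambda>\<omega>. LINT v|\<mu>. \<phi> v \<omega>)"
    by (rule P.integrable_snd[OF i])
  have "expectation (\<lambda>\<omega>. LINT v|\<mu>. \<phi> v \<omega>) = (LINT v|\<mu>. expectation (\<phi> v))"
    by (rule P.Fubini_integral[OF i])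
  also have "\<dots> \<le> (LINT v|\<mu>. L)"
    using i1 L by (intro integral_mono) auto
  finally show "expectation (\<lambda>\<omega>. LINT v|\<mu>. \<phi> v \<omega>) \<le> L * measure \<mu> (space \<mu>)"
    by (simp add: mult.commute)
qed

text \<open>Only linearity of expectation enters, so the bound depends neither on the number of
  blocks nor on their overlap.\<close>

lemma (in prob_space) expectation_scaled_average_le:
  fixes x :: "nat \<Rightarrow> 'a \<Rightarrow> real"
  assumes "\<And>i. i \<in> {1..N} \<Longrightarrow> integrable M (x i)"
    and "\<And>i. i \<in> {1..N} \<Longrightarrow> expectation (x i) \<le> B * a powr (- \<beta>)"
    and "0 < a" "0 \<le> B"
  shows "integrable M (\<lambda>\<omega>. a powr \<beta> * ((\<Sum>i=1..N. x i \<omega>) / real N))"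
    and "expectation (\<lambda>\<omega>. a powr \<beta> * ((\<Sum>i=1..N. x i \<omega>) / real N)) \<le> B"
proof -
  show "integrable M (\<lambda>\<omega>. a powr \<beta> * ((\<Sum>i=1..N. x i \<omega>) / real N))"
    using assms(1) by (intro integrable_mult_right integrable_divide_zero impI Bochner_Integration.integrable_sum) auto
  have "expectation (\<lambda>\<omega>. a powr \<beta> * ((\<Sum>i=1..N. x i \<omega>) / real N))
      = a powr \<beta> * ((\<Sum>i=1..N. expectation (x i)) / real N)"
    using assms(1) by (subst integral_mult_right_zero, subst integral_divide_zero)
      (simp add: Bochner_Integration.integral_sum)
  also have "\<dots> \<le> a powr \<beta> * ((\<Sum>i=1..N. B * a powr (- \<beta>)) / real N)"
    using assms(2) by (intro mult_left_mono divide_right_mono sum_mono) auto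
  also have "\<dots> \<le> B"
  proof (cases "N = 0")
    case False
    have "a powr \<beta> * a powr (- \<beta>) = 1"
      using assms(3) by (simp flip: powr_add)
    then show ?thesis
      using False by (simp add: mult.left_commute)
  qed (use assms(4) in simp)
  finally show "expectation (\<lambda>\<omega>. a powr \<beta> * ((\<Sum>i=1..N. x i \<omega>) / real N)) \<le> B" .
qed

text \<open>The rank controls the orders from 1 on; order 0 is the mean, which vanishes by
  assumption.\<close>

lemma (in standard_gaussian_sequence) hermite_rank_orthogonal:
  assumes [measurable]: "g \<in> borel_measurable borel"
    and "expectation (\<lambda>\<omega>. g (Z 0 \<omega>)) = 0" and "enat m \<le> hermite_rank M (Z 0) g" and "j < m"
  shows "(LINT x|std_normal_distribution. g x * poly (hermite j) x) = 0"
proof (cases "j = 0")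
  case True
  then show ?thesis
    using assms(2) expectation_Z[of g 0] by simp
next
  case False
  have [measurable]: "poly (hermite j) \<in> borel_measurable borel"
    by (intro borel_measurable_continuous_onI continuous_intros)
  show ?thesis
  proof (rule ccontr)
    assume "\<not> ?thesis"
    then have "expectation (\<lambda>\<omega>. g (Z 0 \<omega>) * hermite_poly j (Z 0 \<omega>)) \<noteq> 0"
      using expectation_Z[of "\<lambda>x. g x * poly (hermite j) x" 0] by (simp add: hermite_poly_eq_poly)
    with False have "hermite_rank M (Z 0) g \<le> enat j"
      unfolding hermite_rank_def by (intro Inf_lower imageI) auto
    with assms(3) have "enat m \<le> enat j"
      by (rule order_trans)
    with assms(4) show False
      by simp
  qed
qed

section \<open>Assembly of the stochastic bound for both block schemes\<close>

theorem theorem5p2: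
  fixes M :: "'a measure"
    and Z :: "nat \<Rightarrow> 'a \<Rightarrow> real"
    and Gt :: "real \<Rightarrow> real"
    and T :: "real measure \<Rightarrow> real"
    and F :: "real measure"
    and Fn :: "nat \<Rightarrow> 'a \<Rightarrow> real measure"
    and Y X :: "nat \<Rightarrow> 'a \<Rightarrow> real"
    and Xhat :: "nat \<Rightarrow> nat \<Rightarrow> 'a \<Rightarrow> real"
    and G :: "real \<Rightarrow> real"
    and \<alpha> C\<^sub>0 :: real
    and m :: nat
    and l :: "nat \<Rightarrow> nat"
  assumes "prob_space M"
    and "gaussian_sequence M Z"
    and "stationary_sequence M Z"
    and "\<forall>t. prob_space.expectation M (Z t) = 0"
    and "\<forall>t. prob_space.variance M (Z t) = 1"
    and "0 < C\<^sub>0" and "0 < \<alpha>" and "\<alpha> < 1"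
    and "(\<lambda>k. prob_space.expectation M (\<lambda>\<omega>. Z 0 \<omega> * Z k \<omega>))
           \<sim>[sequentially] (\<lambda>k. C\<^sub>0 * real k powr (- \<alpha>))"
    and "Gt \<in> borel_measurable borel"
    and "Y = (\<lambda>t \<omega>. Gt (Z t \<omega>))"
    and "F = distr M borel (Y 0)"
    and "Fn = (\<lambda>n \<omega>. empirical_distribution n (\<lambda>t. Y t \<omega>))"
    and "has_influence_function T F"
    and "\<forall>n\<ge>1. AE \<omega> in M. has_influence_function T (Fn n \<omega>)"
    and "G = (\<lambda>z. IF T (Gt z) F)"
    and "G \<in> borel_measurable borel"
    and "X = (\<lambda>t \<omega>. G (Z t \<omega>))"
    and "Xhat = (\<lambda>n t \<omega>. IF T (Y t \<omega>) (Fn n \<omega>))"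
    and "\<forall>t. integrable M (\<lambda>\<omega>. (X t \<omega>)\<^sup>2)"
    and "\<forall>t. prob_space.expectation M (X t) = 0"
    and "1 \<le> m"
    and "hermite_rank M (Z 0) G = enat m"
    and "\<alpha> * real m < 1"
    and "condition_I M Z Gt T F Fn \<alpha> m"
    and "\<forall>n. 1 \<le> l n"
    and "(\<lambda>n. 1 / real (l n) + real (l n) / real n) \<longlonglongrightarrow> 0"
  shows "\<forall>V \<in> {V_OL, V_NOL}. \<exists>R\<^sub>1 R\<^sub>2 :: nat \<Rightarrow> 'a \<Rightarrow> real.
      big_Op M R\<^sub>1 (\<lambda>n. (real (l n) / real n) powr (\<alpha> * real m / 2)) \<and>
      big_Op M R\<^sub>2 (\<lambda>n. real n powr (- \<alpha> * real m / 2)) \<and>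
      (\<forall>n\<ge>1. \<forall>\<omega>\<in>space M.
         V n (l n) (\<alpha> * real m) (\<lambda>t. Xhat n t \<omega>)
           = V n (l n) (\<alpha> * real m) (\<lambda>t. X t \<omega>) + R\<^sub>1 n \<omega> + R\<^sub>2 n \<omega>)"
proof -
  interpret prob_space M by fact
  interpret standard_gaussian_sequence M Z
    using assms(2-5) by unfold_locales auto
  note [measurable] = \<open>Gt \<in> borel_measurable borel\<close> \<open>G \<in> borel_measurable borel\<close>
  note X = \<open>X = (\<lambda>t \<omega>. G (Z t \<omega>))\<close> and Y = \<open>Y = (\<lambda>t \<omega>. Gt (Z t \<omega>))\<close>
    and Xhat = \<open>Xhat = (\<lambda>n t \<omega>. IF T (Y t \<omega>) (Fn n \<omega>))\<close> and G = \<open>G = (\<lambda>z. IF T (Gt z) F)\<close>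
  define \<beta> where "\<beta> = \<alpha> * real m"
  have \<beta>: "0 < \<beta>" "\<beta> < 1" "- \<alpha> * real m = - \<beta>"
    using \<open>0 < \<alpha>\<close> \<open>1 \<le> m\<close> \<open>\<alpha> * real m < 1\<close> by (auto simp: \<beta>_def)
  have l: "1 \<le> l n" for n
    using \<open>\<forall>n. 1 \<le> l n\<close> by blast
  obtain U1 U2 W c d C and h :: "real \<Rightarrow> real \<Rightarrow> real" where C: "C > 0"
    and hm: "(\<lambda>(v, y). h v y) \<in> borel_measurable (restrict_space borel {c..d} \<Otimes>\<^sub>M borel)"
    and cond: "\<forall>n\<ge>1. AE \<omega> in M. \<forall>k\<ge>1. \<forall>y :: nat \<Rightarrow> real.
          set_integrable lborel {c..d} (\<lambda>v. \<bar>(\<Sum>j=1..k. h v (y j)) / real k\<bar>\<^sup>2) \<longrightarrow>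
          \<bar>(\<Sum>j=1..k. IF T (y j) F) / real k
            - (\<Sum>j=1..k. IF T (y j) (Fn n \<omega>)) / real k
            + U1 n \<omega>\<bar>
          \<le> \<bar>W n \<omega>\<bar> + \<bar>U2 n \<omega>\<bar> *
              sqrt (LINT v:{c..d}|lborel. \<bar>(\<Sum>j=1..k. h v (y j)) / real k\<bar>\<^sup>2)"
    and W: "big_Op M W (\<lambda>n. real n powr (- \<beta>))"
    and U2: "big_Op M U2 (\<lambda>n. real n powr (- \<beta> / 2))"
    and h': "\<forall>v\<in>{c..d}.
          (\<forall>t. integrable M (\<lambda>\<omega>. (h v (Gt (Z t \<omega>)))\<^sup>2) \<and>
               (LINT \<omega>|M. h v (Gt (Z t \<omega>))) = 0 \<and>
               (LINT \<omega>|M. (h v (Gt (Z t \<omega>)))\<^sup>2) \<le> C) \<and>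
          hermite_rank M (Z 0) (\<lambda>z. h v (Gt z)) \<ge> enat m"
    using \<open>condition_I M Z Gt T F Fn \<alpha> m\<close> unfolding condition_I_def \<beta>(3)
    by (elim exE conjE) (rule that, assumption+)
  have h: "integrable M (\<lambda>\<omega>. (h v (Gt (Z 0 \<omega>)))\<^sup>2)"
      "expectation (\<lambda>\<omega>. h v (Gt (Z 0 \<omega>))) = 0"
      "expectation (\<lambda>\<omega>. (h v (Gt (Z 0 \<omega>)))\<^sup>2) \<le> C"
      "enat m \<le> hermite_rank M (Z 0) (\<lambda>z. h v (Gt z))" if "v \<in> {c..d}" for v
    using h'[rule_format, OF that] by simp_all

  have "autocov \<in> O(\<lambda>k. real k powr (- \<alpha>))"
    using asymp_equiv_imp_bigo[OF assms(9)] \<open>0 < C\<^sub>0\<close> by (simp add: autocov_def[abs_def])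
  from covariance_decay[OF this \<open>0 < \<alpha>\<close>, of m] obtain D where D: "0 \<le> D"
    "\<forall>f\<in>borel_measurable borel. integrable std_normal_distribution (\<lambda>x. (f x)\<^sup>2) \<longrightarrow>
      (\<forall>j<m. (LINT x|std_normal_distribution. f x * poly (hermite j) x) = 0) \<longrightarrow>
      (\<forall>i. \<forall>k\<ge>1. \<bar>expectation (\<lambda>\<omega>. f (Z i \<omega>) * f (Z (i + k) \<omega>))\<bar>
          \<le> D * real k powr (- \<beta>) * (LINT x|std_normal_distribution. (f x)\<^sup>2))"
    unfolding \<beta>_def by (elim exE conjE)
  \<comment> \<open>The factor from \<open>block_mean_second_moment\<close>; as \<open>D\<close>
    does not depend on \<open>f\<close>, it is common to \<open>G\<close> and all
    \<open>h v\<close>.\<close>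
  define c\<^sub>2 where "c\<^sub>2 = 1 + 2 * D / (1 - \<beta>)"
  have c2: "0 \<le> c\<^sub>2"
    using D(1) \<beta> by (simp add: c\<^sub>2_def)
  have block: "integrable M (\<lambda>\<omega>. (block_mean k (\<lambda>t. f (Z t \<omega>)) i)\<^sup>2)"
      "expectation (\<lambda>\<omega>. (block_mean k (\<lambda>t. f (Z t \<omega>)) i)\<^sup>2)
        \<le> c\<^sub>2 * real k powr (- \<beta>) * expectation (\<lambda>\<omega>. (f (Z 0 \<omega>))\<^sup>2)"
    if f[measurable]: "f \<in> borel_measurable borel" and f2: "integrable M (\<lambda>\<omega>. (f (Z 0 \<omega>))\<^sup>2)"
      and f0: "expectation (\<lambda>\<omega>. f (Z 0 \<omega>)) = 0" and fr: "enat m \<le> hermite_rank M (Z 0) f" and k: "1 \<le> k" for f k i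
  proof -
    have i: "integrable std_normal_distribution (\<lambda>x. (f x)\<^sup>2)"
      using f2 integrable_Z_iff[of "\<lambda>x. (f x)\<^sup>2"] by simp
    note orth = hermite_rank_orthogonal[OF f f0 fr]
    show "integrable M (\<lambda>\<omega>. (block_mean k (\<lambda>t. f (Z t \<omega>)) i)\<^sup>2)"
      "expectation (\<lambda>\<omega>. (block_mean k (\<lambda>t. f (Z t \<omega>)) i)\<^sup>2)
        \<le> c\<^sub>2 * real k powr (- \<beta>) * expectation (\<lambda>\<omega>. (f (Z 0 \<omega>))\<^sup>2)"
      using block_mean_second_moment[OF f i D(1) D(2)[rule_format, OF f i orth] \<beta>(1,2) k] expectation_Z[of "\<lambda>x. (f x)\<^sup>2" 0]
      by (simp_all add: c\<^sub>2_def)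
  qed

  \<comment> \<open>Lebesgue measure on \<open>{c..d}\<close> as a finite measure on its own space,
    so that the joint measurability of \<open>h\<close> and Fubini apply.\<close>
  define \<mu> where "\<mu> = restrict_space lborel {c..d}"
  have sp: "space \<mu> = {c..d}"
    by (simp add: \<mu>_def space_restrict_space)
  have [measurable_cong]: "sets \<mu> = sets (restrict_space borel {c..d})"
    by (simp add: \<mu>_def sets_restrict_space)
  have \<mu>: "finite_measure \<mu>"
    using emeasure_bounded_finite[of "{c..d}"]
    by (intro finite_measureI) (simp add: sp, simp add: \<mu>_def emeasure_restrict_space less_top)
  define \<kappa> where "\<kappa> = measure \<mu> (space \<mu>)"
  define \<phi> where "\<phi> = (\<lambda>k i v \<omega>. (block_mean k (\<lambda>t. h v (Gt (Z t \<omega>))) i)\<^sup>2)"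
  have hZ: "(\<lambda>p. h (fst p) (Gt (Z t (snd p)))) \<in> borel_measurable (\<mu> \<Otimes>\<^sub>M M)" for t
    using measurable_compose[OF _ hm, of "\<lambda>p. (fst p, Gt (Z t (snd p)))" "\<mu> \<Otimes>\<^sub>M M"] by simp
  have \<phi>m: "(\<lambda>(v, \<omega>). \<phi> k i v \<omega>) \<in> borel_measurable (\<mu> \<Otimes>\<^sub>M M)" for k i
    unfolding \<phi>_def block_mean_def case_prod_beta using hZ by measurable
  have \<phi>i: "integrable M (\<phi> k i v)" "expectation (\<phi> k i v) \<le> c\<^sub>2 * real k powr (- \<beta>) * C"
    if "v \<in> space \<mu>" "1 \<le> k" for k i v
  proof -
    have v: "v \<in> {c..d}" using that(1) by (simp add: sp)
    have "(\<lambda>y. (v, y)) \<in> measurable borel (restrict_space borel {c..d} \<Otimes>\<^sub>M borel)"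
      using v by (intro measurable_Pair1') (simp add: space_restrict_space)
    from measurable_compose[OF this hm] have [measurable]: "h v \<in> borel_measurable borel"
      by simp
    have [measurable]: "(\<lambda>z. h v (Gt z)) \<in> borel_measurable borel"
      by measurable
    note b = block[of "\<lambda>z. h v (Gt z)", OF _ h(1,2,4)[OF v] that(2)]
    show "integrable M (\<phi> k i v)"
      unfolding \<phi>_def by (rule b(1)) simp
    have "expectation (\<phi> k i v) \<le> c\<^sub>2 * real k powr (- \<beta>) * expectation (\<lambda>\<omega>. (h v (Gt (Z 0 \<omega>)))\<^sup>2)"
      unfolding \<phi>_def by (rule b(2)) simp
    also have "\<dots> \<le> c\<^sub>2 * real k powr (- \<beta>) * C"
      using h(3)[OF v] c2 by (intro mult_left_mono) auto
    finally show "expectation (\<phi> k i v) \<le> c\<^sub>2 * real k powr (- \<beta>) * C" .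
  qed
  have \<phi>0: "0 \<le> \<phi> k i v \<omega>" for k i v \<omega>
    by (simp add: \<phi>_def)
  note Q = integral_of_bounded_means[OF \<mu> \<phi>m \<phi>0 \<phi>i]
  define Q where "Q = (\<lambda>k i \<omega>. LINT v|\<mu>. \<phi> k i v \<omega>)"
  have Q0: "0 \<le> Q k i \<omega>" for k i \<omega>
    unfolding Q_def by (rule integral_nonneg_AE) (simp add: \<phi>0)
  define v where "v = expectation (\<lambda>\<omega>. (G (Z 0 \<omega>))\<^sup>2)"
  have v: "0 \<le> v"
    by (simp add: v_def)
  have Gb: "integrable M (\<lambda>\<omega>. (block_mean k (\<lambda>t. X t \<omega>) i)\<^sup>2)"
      "expectation (\<lambda>\<omega>. (block_mean k (\<lambda>t. X t \<omega>) i)\<^sup>2) \<le> c\<^sub>2 * v * real k powr (- \<beta>)" if "1 \<le> k" for k i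
    using block[of G k i] assms(20,21,23) that by (simp_all add: X v_def ac_simps)

  \<comment> \<open>\<open>N n\<close> is the number of blocks and \<open>s n i\<close> the first
    index of block \<open>i\<close>. The argument asks only that blocks start at index 1 or later,
    so it covers both schemes.\<close>
  have main: "big_Op M (\<lambda>n \<omega>. real (l n) powr \<beta> * emp_var (N n) (\<lambda>i. block_mean (l n) (\<lambda>t. Xhat n t \<omega>) (s n i))
        - real (l n) powr \<beta> * emp_var (N n) (\<lambda>i. block_mean (l n) (\<lambda>t. X t \<omega>) (s n i)))
      (\<lambda>n. (real (l n) / real n) powr (\<beta> / 2))"
    if s: "\<And>n i. 1 \<le> i \<Longrightarrow> 1 \<le> s n i" for N :: "nat \<Rightarrow> nat" and s :: "nat \<Rightarrow> nat \<Rightarrow> nat"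
    unfolding big_Op_def
  proof (intro allI impI)
    fix \<epsilon> :: real assume "\<epsilon> > 0"
    \<comment> \<open>Four exceptional events share \<open>\<epsilon>\<close>: those of
      \<open>W\<close>, of \<open>U2\<close>, of the oracle average and of the average of
      \<open>Q\<close>. The null set from Condition-I adds no probability.\<close>
    define \<delta> where "\<delta> = \<epsilon> / 4"
    have \<delta>: "\<delta> > 0" using \<open>\<epsilon> > 0\<close> by (simp add: \<delta>_def)
    obtain K\<^sub>1 where K1: "\<forall>\<^sub>F n in sequentially. \<exists>A\<in>sets M.
        {\<omega>\<in>space M. \<bar>W n \<omega>\<bar> > K\<^sub>1 * real n powr (- \<beta>)} \<subseteq> A \<and> measure M A \<le> \<delta>"
      using W \<delta> unfolding big_Op_def by blast
    obtain K\<^sub>2 where K2: "\<forall>\<^sub>F n in sequentially. \<exists>A\<in>sets M.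
        {\<omega>\<in>space M. \<bar>U2 n \<omega>\<bar> > K\<^sub>2 * real n powr (- \<beta> / 2)} \<subseteq> A \<and> measure M A \<le> \<delta>"
      using U2 \<delta> unfolding big_Op_def by blast
    \<comment> \<open>The added 1 makes the bound on the expectation strictly positive, as
      \<open>Markov_tail\<close> demands.\<close>
    define K\<^sub>3 where "K\<^sub>3 = (c\<^sub>2 * v + 1) / \<delta>"
    define K\<^sub>4 where "K\<^sub>4 = (c\<^sub>2 * C * \<kappa> + 1) / \<delta>"
    define K\<^sub>5 where "K\<^sub>5 = 2 * K\<^sub>1\<^sup>2 + 2 * K\<^sub>2\<^sup>2 * K\<^sub>4"
    define K where "K = K\<^sub>5 + 2 * sqrt (K\<^sub>3 * K\<^sub>5)"
    have B: "0 \<le> c\<^sub>2 * v" "0 \<le> c\<^sub>2 * C * \<kappa>"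
      using c2 v C by (auto simp: \<kappa>_def)
    then have K34: "0 \<le> K\<^sub>3" "0 \<le> K\<^sub>4"
      using \<delta> by (auto simp: K\<^sub>3_def K\<^sub>4_def)
    then have "0 \<le> K"
      by (simp add: K_def K\<^sub>5_def)
    have "\<forall>\<^sub>F n in sequentially. 1 / real (l n) + real (l n) / real n < 1"
      using assms(27) by (rule order_tendstoD) simp
    then have ln: "\<forall>\<^sub>F n in sequentially. 1 \<le> n \<and> l n \<le> n"
      using eventually_ge_at_top[of 1]
    proof eventually_elim
      case (elim n)
      have "real (l n) / real n < 1"
        using elim(1) by (smt (verit) divide_nonneg_nonneg of_nat_0_le_iff)
      then show ?case
        using elim(2) by simp
    qed
    let ?A = "\<lambda>n \<omega>. real (l n) powr \<beta> * ((\<Sum>i=1..N n. (block_mean (l n) (\<lambda>t. X t \<omega>) (s n i))\<^sup>2) / real (N n))"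
    let ?Q = "\<lambda>n \<omega>. real (l n) powr \<beta> * ((\<Sum>i=1..N n. Q (l n) (s n i) \<omega>) / real (N n))"
    let ?R = "\<lambda>n \<omega>. real (l n) powr \<beta> * emp_var (N n) (\<lambda>i. block_mean (l n) (\<lambda>t. Xhat n t \<omega>) (s n i))
        - real (l n) powr \<beta> * emp_var (N n) (\<lambda>i. block_mean (l n) (\<lambda>t. X t \<omega>) (s n i))"
    show "\<exists>K>0. \<forall>\<^sub>F n in sequentially. \<exists>A\<in>sets M.
        {\<omega>\<in>space M. \<bar>?R n \<omega>\<bar> > K * (real (l n) / real n) powr (\<beta> / 2)} \<subseteq> A \<and> measure M A \<le> \<epsilon>"
    \<comment> \<open>\<open>K\<close> may be 0, while \<open>big_Op\<close> asks for a positive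
      constant.\<close>
    proof (intro exI[of _ "K + 1"] conjI)
      show "0 < K + 1" using \<open>0 \<le> K\<close> by simp
      show "\<forall>\<^sub>F n in sequentially. \<exists>A\<in>sets M.
        {\<omega>\<in>space M. \<bar>?R n \<omega>\<bar> > (K + 1) * (real (l n) / real n) powr (\<beta> / 2)} \<subseteq> A \<and> measure M A \<le> \<epsilon>"
        using K1 K2 ln
      proof eventually_elim
        case (elim n)
        then obtain A1 A2 where A1: "A1 \<in> sets M" "{\<omega>\<in>space M. \<bar>W n \<omega>\<bar> > K\<^sub>1 * real n powr (- \<beta>)} \<subseteq> A1" "prob A1 \<le> \<delta>"
          and A2: "A2 \<in> sets M" "{\<omega>\<in>space M. \<bar>U2 n \<omega>\<bar> > K\<^sub>2 * real n powr (- \<beta> / 2)} \<subseteq> A2" "prob A2 \<le> \<delta>"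
          by blast
        have n: "1 \<le> n" "l n \<le> n" using elim(3) by auto
        define A3 where "A3 = {\<omega>\<in>space M. ?A n \<omega> > K\<^sub>3}"
        define A4 where "A4 = {\<omega>\<in>space M. ?Q n \<omega> > K\<^sub>4}"
        have l0: "0 < real (l n)" using l[of n] by simp
        have iA: "integrable M (?A n)" "expectation (?A n) \<le> c\<^sub>2 * v"
          by (rule expectation_scaled_average_le[OF Gb(1)[OF l] Gb(2)[OF l] l0 B(1)])+
        have Qi: "integrable M (Q (l n) i)" "expectation (Q (l n) i) \<le> c\<^sub>2 * C * \<kappa> * real (l n) powr (- \<beta>)" for i
          using Q(2,3)[of "l n" i] l[of n] by (simp_all add: Q_def \<kappa>_def ac_simps)
        have iQ: "integrable M (?Q n)" "expectation (?Q n) \<le> c\<^sub>2 * C * \<kappa>"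
          by (rule expectation_scaled_average_le[OF Qi l0 B(2)])+
        have A3: "A3 \<in> sets M" "prob A3 \<le> \<delta>"
        proof -
          have nonneg: "0 \<le> ?A n \<omega>" for \<omega>
            by (intro mult_nonneg_nonneg divide_nonneg_nonneg sum_nonneg ) simp_all
          have bound: "expectation (?A n) \<le> c\<^sub>2 * v + 1" "0 < c\<^sub>2 * v + 1"
            using iA(2) B(1) by linarith+
          show "A3 \<in> sets M" "prob A3 \<le> \<delta>"
            unfolding A3_def K\<^sub>3_def by (rule Markov_tail[OF iA(1) nonneg bound(1) \<delta> bound(2)])+
        qed
        have A4: "A4 \<in> sets M" "prob A4 \<le> \<delta>"
        proof -
          have nonneg: "0 \<le> ?Q n \<omega>" for \<omega>
            by (intro mult_nonneg_nonneg divide_nonneg_nonneg sum_nonneg Q0 ) simp_all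
          have bound: "expectation (?Q n) \<le> c\<^sub>2 * C * \<kappa> + 1" "0 < c\<^sub>2 * C * \<kappa> + 1"
            using iQ(2) B(2) by linarith+
          show "A4 \<in> sets M" "prob A4 \<le> \<delta>"
            unfolding A4_def K\<^sub>4_def by (rule Markov_tail[OF iQ(1) nonneg bound(1) \<delta> bound(2)])+
        qed
        let ?e = "\<lambda>\<omega> i. block_mean (l n) (\<lambda>t. X t \<omega>) (s n i) - block_mean (l n) (\<lambda>t. Xhat n t \<omega>) (s n i) + U1 n \<omega>"
        \<comment> \<open>There are finitely many blocks, so outside one null set the integrals are
          finite for all of them. Condition-I holds simultaneously for all \<open>y\<close>, which
          permits inserting the random values \<open>Y (s n i + j - 1) \<omega>\<close>.\<close>
        have "AE \<omega> in M. \<forall>i\<in>{1..N n}. integrable \<mu> (\<lambda>v. \<phi> (l n) (s n i) v \<omega>)"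
          using Q(1)[of "l n"] l[of n] by (intro AE_finite_allI) auto
        then have "AE \<omega> in M. \<forall>i\<in>{1..N n}. \<bar>?e \<omega> i\<bar> \<le> \<bar>W n \<omega>\<bar> + \<bar>U2 n \<omega>\<bar> * sqrt (Q (l n) (s n i) \<omega>)"
          using cond[rule_format, OF n(1)]
        proof eventually_elim
          case (elim \<omega>)
          show ?case
          proof
            fix i assume i: "i \<in> {1..N n}"
            then have si: "1 \<le> s n i" using s by simp
            have eq: "\<bar>(\<Sum>j=1..l n. h v (Y (s n i + j - 1) \<omega>)) / real (l n)\<bar>\<^sup>2 = \<phi> (l n) (s n i) v \<omega>" for v
              using block_mean_shift[OF l[of n] si, of "\<lambda>t. h v (Y t \<omega>)"] by (simp add: \<phi>_def Y)
            have "set_integrable lborel {c..d} (\<lambda>v. \<phi> (l n) (s n i) v \<omega>)"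
              using elim(1) i by (simp add: \<mu>_def integrable_restrict_space set_integrable_def)
            moreover have "(LINT v:{c..d}|lborel. \<phi> (l n) (s n i) v \<omega>) = Q (l n) (s n i) \<omega>"
              by (simp add: Q_def \<mu>_def integral_restrict_space set_lebesgue_integral_def)
            moreover have "(\<Sum>j=1..l n. IF T (Y (s n i + j - 1) \<omega>) F) / real (l n) = block_mean (l n) (\<lambda>t. X t \<omega>) (s n i)"
              using block_mean_shift[OF l[of n] si, of "\<lambda>t. X t \<omega>"] by (simp add: X G Y)
            moreover have "(\<Sum>j=1..l n. IF T (Y (s n i + j - 1) \<omega>) (Fn n \<omega>)) / real (l n)
                = block_mean (l n) (\<lambda>t. Xhat n t \<omega>) (s n i)"
              using block_mean_shift[OF l[of n] si, of "\<lambda>t. Xhat n t \<omega>"] by (simp add: Xhat)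
            ultimately show "\<bar>?e \<omega> i\<bar> \<le> \<bar>W n \<omega>\<bar> + \<bar>U2 n \<omega>\<bar> * sqrt (Q (l n) (s n i) \<omega>)"
              using elim(2)[rule_format, OF l[of n], of "\<lambda>j. Y (s n i + j - 1) \<omega>"] unfolding eq by simp
          qed
        qed
        then obtain A5 where A5: "A5 \<in> null_sets M"
          "\<And>\<omega>. \<lbrakk>\<omega> \<in> space M; \<omega> \<notin> A5\<rbrakk> \<Longrightarrow>
            \<forall>i\<in>{1..N n}. \<bar>?e \<omega> i\<bar> \<le> \<bar>W n \<omega>\<bar> + \<bar>U2 n \<omega>\<bar> * sqrt (Q (l n) (s n i) \<omega>)"
          by (rule AE_E3) blast
        have R: "\<bar>?R n \<omega>\<bar> \<le> K * (real (l n) / real n) powr (\<beta> / 2)"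
          if \<omega>: "\<omega> \<in> space M" "\<omega> \<notin> A1 \<union> A2 \<union> A3 \<union> A4 \<union> A5" for \<omega>
          unfolding K_def
        proof (rule emp_var_block_perturbation)
          show "block_mean (l n) (\<lambda>t. Xhat n t \<omega>) (s n i) = block_mean (l n) (\<lambda>t. X t \<omega>) (s n i) + U1 n \<omega> - ?e \<omega> i" for i
            by simp
          show "\<bar>?e \<omega> i\<bar> \<le> \<bar>W n \<omega>\<bar> + \<bar>U2 n \<omega>\<bar> * sqrt (Q (l n) (s n i) \<omega>)" if "i \<in> {1..N n}" for i
            using A5(2)[OF \<omega>(1)] \<omega>(2) that by blast
          show "\<bar>W n \<omega>\<bar> \<le> K\<^sub>1 * real n powr (- \<beta>)"
            using A1(2) \<omega> by (force simp: not_less[symmetric])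
          show "\<bar>U2 n \<omega>\<bar> \<le> K\<^sub>2 * real n powr (- \<beta> / 2)"
            using A2(2) \<omega> by (force simp: not_less[symmetric])
          show "?A n \<omega> \<le> K\<^sub>3"
            using \<omega> by (simp add: A3_def not_less)
          show "?Q n \<omega> \<le> K\<^sub>4"
            using \<omega> by (simp add: A4_def not_less)
        qed (use l n \<beta> K34 Q0 K\<^sub>5_def in auto)
        have A5': "A5 \<in> sets M" "prob A5 = 0"
          using A5(1) by (auto simp: measure_eq_0_null_sets)
        have "prob (A1 \<union> A2 \<union> A3 \<union> A4 \<union> A5) \<le> prob (A1 \<union> A2 \<union> A3 \<union> A4) + prob A5"
          using A1 A2 A3 A4 A5' by (intro measure_Un_le) auto
        also have "prob (A1 \<union> A2 \<union> A3 \<union> A4) \<le> prob (A1 \<union> A2 \<union> A3) + prob A4"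
          using A1 A2 A3 A4 by (intro measure_Un_le) auto
        also have "prob (A1 \<union> A2 \<union> A3) \<le> prob (A1 \<union> A2) + prob A3"
          using A1 A2 A3 by (intro measure_Un_le) auto
        also have "prob (A1 \<union> A2) \<le> prob A1 + prob A2"
          using A1 A2 by (intro measure_Un_le) auto
        finally have p: "prob (A1 \<union> A2 \<union> A3 \<union> A4 \<union> A5) \<le> \<epsilon>"
          using A1(3) A2(3) A3(2) A4(2) A5'(2) by (simp add: \<delta>_def)
        show ?case
        proof (rule bexI[of _ "A1 \<union> A2 \<union> A3 \<union> A4 \<union> A5"], rule conjI)
          show "{\<omega>\<in>space M. \<bar>?R n \<omega>\<bar> > (K + 1) * (real (l n) / real n) powr (\<beta> / 2)} \<subseteq> A1 \<union> A2 \<union> A3 \<union> A4 \<union> A5"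
          proof (rule subsetI, rule ccontr)
            fix \<omega> assume a: "\<omega> \<in> {\<omega>\<in>space M. \<bar>?R n \<omega>\<bar> > (K + 1) * (real (l n) / real n) powr (\<beta> / 2)}"
              and "\<omega> \<notin> A1 \<union> A2 \<union> A3 \<union> A4 \<union> A5"
            then have "\<bar>?R n \<omega>\<bar> \<le> K * (real (l n) / real n) powr (\<beta> / 2)"
              using R[of \<omega>] by blast
            also have "\<dots> \<le> (K + 1) * (real (l n) / real n) powr (\<beta> / 2)"
              by (intro mult_right_mono) auto
            finally show False
              using a by simp
          qed
        qed (use p A1 A2 A3 A4 A5' in auto)
      qed
    qed
  qed
  \<comment> \<open>The whole difference goes into the first remainder; the second is chosen to be
    0.\<close>
  have zero: "big_Op M (\<lambda>n \<omega>. 0) (\<lambda>n. real n powr (- \<alpha> * real m / 2))"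
    unfolding big_Op_def
  proof (intro allI impI exI[of _ 1] conjI always_eventually bexI[of _ "{}"])
  qed auto
  show ?thesis
  proof
    fix V assume "V \<in> {V_OL, V_NOL}"
    then obtain N :: "nat \<Rightarrow> nat" and s :: "nat \<Rightarrow> nat \<Rightarrow> nat" where s: "\<And>n i. 1 \<le> i \<Longrightarrow> 1 \<le> s n i"
      and V: "\<And>n x. V n (l n) \<beta> x = real (l n) powr \<beta> * emp_var (N n) (\<lambda>i. block_mean (l n) x (s n i))"
    proof (elim insertE emptyE)
      assume "V = V_OL"
      then show thesis
        by (intro that[of "\<lambda>n i. i" "\<lambda>n. n - l n + 1"]) (simp_all add: V_OL_eq_emp_var)
    next
      assume "V = V_NOL"
      then show thesis
        by (intro that[of "\<lambda>n i. 1 + (i - 1) * l n" "\<lambda>n. n div l n"]) (simp_all add: V_NOL_eq_emp_var)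
    qed
    show "\<exists>R\<^sub>1 R\<^sub>2 :: nat \<Rightarrow> 'a \<Rightarrow> real.
      big_Op M R\<^sub>1 (\<lambda>n. (real (l n) / real n) powr (\<alpha> * real m / 2)) \<and>
      big_Op M R\<^sub>2 (\<lambda>n. real n powr (- \<alpha> * real m / 2)) \<and>
      (\<forall>n\<ge>1. \<forall>\<omega>\<in>space M.
         V n (l n) (\<alpha> * real m) (\<lambda>t. Xhat n t \<omega>)
           = V n (l n) (\<alpha> * real m) (\<lambda>t. X t \<omega>) + R\<^sub>1 n \<omega> + R\<^sub>2 n \<omega>)"
      unfolding \<beta>_def[symmetric] V
      by (rule exI, rule exI[of _ "\<lambda>_ _. 0"], rule conjI[OF main[of s N, OF s]]) (use zero in \<open>auto simp: \<beta>_def\<close>)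
  qed
qed

end
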